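(* Let $\mathcal M$ be an additive-MDP with $k$ components. If $k=2$, there exists a static commitment that is a $\phi$-pointwise approximation for $\mathcal M$, where $\phi=(1+\sqrt5)/2$. If $k\ge3$, a static commitment of minimum index (among all static commitments) is a $\big(1+\lfloor\frac{k+1}{2}\rfloor\big)$-pointwise approximation for $\mathcal M$.
   Context: An additive box has $k\ge1$ components: independent nonnegative random variables $V_j\sim\mathcal D_j$ (finite support) with probing costs $c_j\ge0$, $j\in[k]$; paying $c_j$ reveals $V_j$, and the box can be accepted only after all components are probed, at cost $\sum_j V_j$. The additive-MDP $\mathcal M$ has states recording which components are probed and their values, actions "probe unprobed component $j$" (cost $c_j$), and terminal states (all probed) of value $\sum_jV_j$. A commitment $\pi$ assigns to each state a distribution over available probes; $\mathcal M^\pi$ is the resulting Markov chain. A static commitment probes the components in a fixed order independent of realized values. For an MDP $\mathcal N$ and $y\in\mathbb R$, in the local game $(\mathcal N,y)$ a policy advances $\mathcal N$ (paying action costs) and finally accepts either an outside option of cost $y$ or a terminal state of $\mathcal N$ (paying its value); $f_{\mathcal N}(y)$ is the minimum expected total cost. The water filling surrogate cost $W^*_{\mathcal N}$ is the random variable with $\mathbb E[\min(y,W^*_{\mathcal N})]=f_{\mathcal N}(y)$ for all $y$. The index of a commitment $\pi$ is $g^\pi=\max\{y: f_{\mathcal M^\pi}(y)=y\}$, i.e. the minimum of the support of $W^*_{\mathcal M^\pi}$. For a random variable $Z$ and $q\in[0,1]$, $Z(q)=\inf\{x:\Pr[Z\le x]\ge q\}$. A commitment $\pi$ is an $\alpha$-pointwise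 approximation for $\mathcal M$ if $W^*_{\mathcal M^\pi}(q)\le\alpha W^*_{\mathcal M}(q)$ for all $q\in[0,1]$. *)

theory Defs
  imports "HOL-Probability.Probability"
begin

text \<open>For additive boxes all successor distributions have finite support, so the expectations in the
  definitions below are finite sums.\<close>

record ('s, 'a) mdp =
  init :: 's
  avail :: "'s \<Rightarrow> 'a set"
  act_cost :: "'s \<Rightarrow> 'a \<Rightarrow> real"
  trans :: "'s \<Rightarrow> 'a \<Rightarrow> 's pmf"
  terminal :: "'s set"
  val :: "'s \<Rightarrow> real"

text \<open>Policies of the local game are decision trees. The continuation after an action may depend
  on the whole history, and \<open>Mix p A B\<close> randomizes: it follows \<open>A\<close> with probability \<open>p\<close> and \<open>B\<close>
  otherwise.\<close>

datatype ('s, 'a) policy =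
    Accept_Outside
  | Accept_Terminal
  | Advance 'a "'s \<Rightarrow> ('s, 'a) policy"
  | Mix real "('s, 'a) policy" "('s, 'a) policy"

primrec feasible :: "('s, 'a) mdp \<Rightarrow> ('s, 'a) policy \<Rightarrow> 's \<Rightarrow> bool" where
  "feasible N Accept_Outside = (\<lambda>s. True)"
| "feasible N Accept_Terminal = (\<lambda>s. s \<in> terminal N)"
| "feasible N (Advance a P) =
    (\<lambda>s. a \<in> avail N s \<and> (\<forall>s'\<in>set_pmf (trans N s a). feasible N (P s') s'))"
| "feasible N (Mix p A B) = (\<lambda>s. 0 \<le> p \<and> p \<le> 1 \<and> feasible N A s \<and> feasible N B s)"

primrec expected_cost :: "('s, 'a) mdp \<Rightarrow> real \<Rightarrow> ('s, 'a) policy \<Rightarrow> 's \<Rightarrow> real" where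
  "expected_cost N y Accept_Outside = (\<lambda>s. y)"
| "expected_cost N y Accept_Terminal = (\<lambda>s. val N s)"
| "expected_cost N y (Advance a P) =
    (\<lambda>s. act_cost N s a +
         measure_pmf.expectation (trans N s a) (\<lambda>s'. expected_cost N y (P s') s'))"
| "expected_cost N y (Mix p A B) =
    (\<lambda>s. p * expected_cost N y A s + (1 - p) * expected_cost N y B s)"

definition local_cost :: "('s, 'a) mdp \<Rightarrow> real \<Rightarrow> real" where
  "local_cost N y = (INF P\<in>{P. feasible N P (init N)}. expected_cost N y P (init N))"

definition is_surrogate_cost :: "('s, 'a) mdp \<Rightarrow> real measure \<Rightarrow> bool" where
  "is_surrogate_cost N W \<longleftrightarrow> real_distribution W \<and>
     (\<forall>y. integrable W (\<lambda>w. min y w) \<and> (\<integral>w. min y w \<partial>W) = local_cost N y)"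

text \<open>The surrogate cost is represented by its law. The law is unique, because \<open>y \<mapsto> E[min(y, W)]\<close>
  determines the distribution function of \<open>W\<close> through its right derivative.\<close>

definition surrogate_cost :: "('s, 'a) mdp \<Rightarrow> real measure" where
  "surrogate_cost N = (THE W. is_surrogate_cost N W)"

text \<open>Taken in the extended reals, because the infimum is \<open>- \<infinity>\<close> for \<open>q = 0\<close>.\<close>

definition quantile :: "real measure \<Rightarrow> real \<Rightarrow> ereal" where
  "quantile Z q = (INF x\<in>{x. q \<le> cdf Z x}. ereal x)"

definition is_commitment :: "('s, 'a) mdp \<Rightarrow> ('s \<Rightarrow> 'a pmf) \<Rightarrow> bool" where
  "is_commitment N \<pi> \<longleftrightarrow> (\<forall>s. avail N s \<noteq> {} \<longrightarrow> set_pmf (\<pi> s) \<subseteq> avail N s)"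

text \<open>The Markov chain induced by a commitment, as an MDP whose only action is to take one step.\<close>

definition chain :: "('s, 'a) mdp \<Rightarrow> ('s \<Rightarrow> 'a pmf) \<Rightarrow> ('s, unit) mdp" where
  "chain N \<pi> =
    \<lparr> init = init N,
      avail = (\<lambda>s. if avail N s = {} then {} else {()}),
      act_cost = (\<lambda>s _. measure_pmf.expectation (\<pi> s) (act_cost N s)),
      trans = (\<lambda>s _. bind_pmf (\<pi> s) (trans N s)),
      terminal = terminal N,
      val = val N \<rparr>"

definition index :: "('s, 'a) mdp \<Rightarrow> ('s \<Rightarrow> 'a pmf) \<Rightarrow> real" where
  "index N \<pi> = (GREATEST y. local_cost (chain N \<pi>) y = y)"

definition pointwise_approx :: "('s, 'a) mdp \<Rightarrow> ('s \<Rightarrow> 'a pmf) \<Rightarrow> real \<Rightarrow> bool" where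
  "pointwise_approx N \<pi> \<alpha> \<longleftrightarrow> is_commitment N \<pi> \<and>
     (\<forall>q\<in>{0..1}. quantile (surrogate_cost (chain N \<pi>)) q
                  \<le> ereal \<alpha> * quantile (surrogate_cost N) q)"

text \<open>The components of an additive box are numbered \<open>0, \<dots>, k - 1\<close>; \<open>D j\<close> is the distribution of
  the value of component \<open>j\<close> and \<open>c j\<close> its probing cost.\<close>

definition additive_box :: "nat \<Rightarrow> (nat \<Rightarrow> real pmf) \<Rightarrow> (nat \<Rightarrow> real) \<Rightarrow> bool" where
  "additive_box k D c \<longleftrightarrow> 1 \<le> k \<and>
     (\<forall>j<k. finite (set_pmf (D j)) \<and> set_pmf (D j) \<subseteq> {0..} \<and> 0 \<le> c j)"

text \<open>A state maps every probed component to its value. Independence of the components is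
  built in, as each probe draws from \<open>D j\<close> whatever the current state is.\<close>

definition additive_mdp ::
    "nat \<Rightarrow> (nat \<Rightarrow> real pmf) \<Rightarrow> (nat \<Rightarrow> real) \<Rightarrow> (nat \<rightharpoonup> real, nat) mdp" where
  "additive_mdp k D c =
    \<lparr> init = Map.empty,
      avail = (\<lambda>s. {..<k} - dom s),
      act_cost = (\<lambda>s j. c j),
      trans = (\<lambda>s j. map_pmf (\<lambda>v. s(j \<mapsto> v)) (D j)),
      terminal = {s. dom s = {..<k}},
      val = (\<lambda>s. \<Sum>j<k. the (s j)) \<rparr>"

text \<open>The order \<open>\<sigma>\<close> lists all components. States whose probed components do not form a prefix of
  \<open>\<sigma>\<close> are never reached, so the commitment is unconstrained there.\<close>

definition static_commitment ::
    "nat \<Rightarrow> (nat \<Rightarrow> real pmf) \<Rightarrow> (nat \<Rightarrow> real) \<Rightarrow> ((nat \<rightharpoonup> real) \<Rightarrow> nat pmf) \<Rightarrow> bool" where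
  "static_commitment k D c \<pi> \<longleftrightarrow> is_commitment (additive_mdp k D c) \<pi> \<and>
     (\<exists>\<sigma>. distinct \<sigma> \<and> set \<sigma> = {..<k} \<and>
        (\<forall>i<k. \<forall>s. dom s = set (take i \<sigma>) \<longrightarrow> \<pi> s = return_pmf (\<sigma> ! i)))"

definition min_index_static ::
    "nat \<Rightarrow> (nat \<Rightarrow> real pmf) \<Rightarrow> (nat \<Rightarrow> real) \<Rightarrow> ((nat \<rightharpoonup> real) \<Rightarrow> nat pmf) \<Rightarrow> bool" where
  "min_index_static k D c \<pi> \<longleftrightarrow> static_commitment k D c \<pi> \<and>
     (\<forall>\<pi>'. static_commitment k D c \<pi>' \<longrightarrow>
        index (additive_mdp k D c) \<pi> \<le> index (additive_mdp k D c) \<pi>')"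

end

theory Submission
  imports Defs
begin

text \<open>Write the optimal cost of a local game with outside option \<open>y\<close> as \<open>y - G y\<close>. The gain \<open>G\<close> is
  convex, its zero set is \<open>(-\<infinity>, g]\<close> with \<open>g\<close> the index, and its right derivative is the distribution
  function of the surrogate cost; pointwise approximation therefore compares increments of gains.
  An increment of the adaptive gain from \<open>w\<close> to \<open>z\<close> is at most that of the gain of the box with all
  costs set to zero. Conversely, a static order whose proper suffixes all have index at most \<open>B\<close>
  never stops with a budget \<open>w + B\<close> at least its own index while the values seen so far sum to at
  most \<open>w\<close>, so its increment from \<open>w + B\<close> to \<open>z + B\<close> is at least that of the free box.
  Suffixes have smaller indices than the whole order, so it remains to bound the smallest static
  index by \<open>\<lfloor>(k + 1) / 2\<rfloor>\<close> times the adaptive one, by induction in steps of two: let \<open>i\<close> be the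
  first component probed adaptively, \<open>j\<close> the component that starts an adaptive policy on the rest
  just above the index of the rest, and \<open>\<sigma>\<close> a static order of the others with index at most \<open>B\<close>.
  Increments show that the gain of \<open>j # \<sigma>\<close> at \<open>w + B\<close> dominates the adaptive gain at \<open>w\<close>, up to an
  arbitrarily small error, so probing \<open>i\<close> first pays off as soon as the budget is raised by \<open>B\<close>.\<close>

subsection \<open>Gain functions\<close>

text \<open>These are the properties of \<open>y - E[min(y, W)]\<close> for a nonnegative
  \<open>W\<close> of finite mean; the last clause says that the local cost \<open>z - G z\<close>
  is bounded.\<close>

definition gain_function :: "(real \<Rightarrow> real) \<Rightarrow> bool" where
  "gain_function G \<longleftrightarrow> (\<forall>z\<le>0. G z = 0) \<and>
     (\<forall>w z. w \<le> z \<longrightarrow> G w \<le> G z \<and> G z - G w \<le> z - w) \<and>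
     convex_on UNIV G \<and> (\<exists>C. \<forall>z. z - C \<le> G z)"

lemma gain_function_nonpos: "gain_function G \<Longrightarrow> z \<le> 0 \<Longrightarrow> G z = 0"
  by (simp add: gain_function_def)

lemma gain_function_mono: "gain_function G \<Longrightarrow> w \<le> z \<Longrightarrow> G w \<le> G z"
  by (simp add: gain_function_def)

lemma gain_function_diff_le: "gain_function G \<Longrightarrow> w \<le> z \<Longrightarrow> G z - G w \<le> z - w"
  by (simp add: gain_function_def)

lemma gain_function_convex: "gain_function G \<Longrightarrow> convex_on UNIV G"
  by (simp add: gain_function_def)

lemma gain_function_ge: "gain_function G \<Longrightarrow> \<exists>C. \<forall>z. z - C \<le> G z"
  by (simp add: gain_function_def)

lemma gain_function_nonneg: "gain_function G \<Longrightarrow> 0 \<le> G z"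
  by (metis gain_function_mono gain_function_nonpos linorder_le_cases order_refl)

lemma gain_function_continuous:
  assumes "gain_function G"
  shows "continuous_on S G"
proof -
  have "dist (G x) (G y) \<le> 1 * dist x y" for x y
    using gain_function_mono[OF assms, of x y] gain_function_mono[OF assms, of y x]
      gain_function_diff_le[OF assms, of x y] gain_function_diff_le[OF assms, of y x]
    by (cases "x \<le> y") (auto simp: dist_real_def)
  then have "1-lipschitz_on S G"
    by (intro lipschitz_onI) auto
  then show ?thesis
    by (rule lipschitz_on_continuous_on)
qed

lemma gain_function_slopes:
  assumes "gain_function G" "a < b" "b < d"
  shows "(G b - G a) / (b - a) \<le> (G d - G a) / (d - a)"
    and "(G d - G a) / (d - a) \<le> (G d - G b) / (d - b)"
proof -
  have flip: "(u - v) / (x - y) = (v - u) / (y - x)" for u v x y :: real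
    by (metis minus_diff_eq minus_divide_divide)
  show "(G b - G a) / (b - a) \<le> (G d - G a) / (d - a)"
    using convex_on_slope_le(1)[OF gain_function_convex[OF assms(1)], of a d b] assms(2,3)
      flip[of "G a" "G b" a b] flip[of "G a" "G d" a d] by simp
  show "(G d - G a) / (d - a) \<le> (G d - G b) / (d - b)"
    using convex_on_slope_le(2)[OF gain_function_convex[OF assms(1)], of a d b] assms(2,3)
      flip[of "G b" "G d" b d] flip[of "G a" "G d" a d] by simp
qed

lemma gain_function_increment_mono:
  assumes G: "gain_function G" and "w \<le> z" "0 \<le> h"
  shows "G (w + h) - G w \<le> G (z + h) - G z"
proof (cases "w = z \<or> h = 0")
  case False
  with assms have wz: "w < z" "0 < h" by auto
  have "(G (w + h) - G w) / h \<le> (G (z + h) - G w) / (z + h - w)"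
    using gain_function_slopes(1)[OF G, of w "w + h" "z + h"] wz by simp
  also have "\<dots> \<le> (G (z + h) - G z) / h"
    using gain_function_slopes(2)[OF G, of w z "z + h"] wz by simp
  finally show ?thesis
    using wz by (simp add: divide_le_cancel)
qed auto

subsection \<open>Indices\<close>

definition gain_index :: "(real \<Rightarrow> real) \<Rightarrow> real" where
  "gain_index G = Sup {z. G z = 0}"

text \<open>The zero set is downward closed since \<open>G\<close> is monotone and nonnegative,
  bounded since \<open>z - C \<le> G z\<close>, and closed since \<open>G\<close> is continuous: a
  half-line containing its supremum.\<close>

lemma gain_zero_iff:
  assumes G: "gain_function G"
  shows "G z = 0 \<longleftrightarrow> z \<le> gain_index G"
proof -
  let ?Z = "{z. G z = 0}"
  obtain C where C: "z - C \<le> G z" for z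
    using gain_function_ge[OF G] by blast
  have bdd: "bdd_above ?Z"
    using C by (intro bdd_aboveI[of _ C]) (metis diff_le_0_iff_le mem_Collect_eq)
  have ne: "?Z \<noteq> {}"
    using gain_function_nonpos[OF G] by blast
  have cl: "closed ?Z"
    using continuous_closed_vimage[of "{0}" G] gain_function_continuous[OF G, of UNIV]
    by (auto simp: vimage_def continuous_on_eq_continuous_at)
  have top: "G (gain_index G) = 0"
    using closed_contains_Sup[OF ne bdd cl] by (simp add: gain_index_def)
  show ?thesis
  proof
    assume "G z = 0"
    then show "z \<le> gain_index G"
      using cSup_upper[of z ?Z] bdd by (simp add: gain_index_def)
  next
    assume "z \<le> gain_index G"
    then show "G z = 0"
      using gain_function_mono[OF G, of z "gain_index G"] gain_function_nonneg[OF G, of z] top by simp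
  qed
qed

lemma gain_pos_iff: "gain_function G \<Longrightarrow> 0 < G z \<longleftrightarrow> gain_index G < z"
  using gain_zero_iff[of G z] gain_function_nonneg[of G z] by auto

lemma gain_index_nonneg: "gain_function G \<Longrightarrow> 0 \<le> gain_index G"
  by (metis gain_function_nonpos gain_zero_iff order_refl)

lemma gain_index_le_iff:
  assumes "gain_function G"
  shows "gain_index G \<le> z \<longleftrightarrow> (\<forall>w>z. 0 < G w)"
  using gain_pos_iff[OF assms] by (metis dense not_le order.strict_trans not_less_iff_gr_or_eq le_less_trans)

lemma Greatest_gain_zero:
  assumes "gain_function G"
  shows "(GREATEST y. y - G y = y) = gain_index G"
  using gain_zero_iff[OF assms] by (intro Greatest_equality) auto

subsection \<open>Existence and uniqueness of surrogate costs\<close>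

text \<open>Over \<open>n\<close> equal pieces of the interval the bounds telescope to
  \<open>(F b - F a) * (b - a) / n\<close>, which is at most \<open>(b - a) / n\<close> and tends to
  0.\<close>

lemma const_of_mono_bound:
  fixes d F :: "real \<Rightarrow> real"
  assumes d: "\<And>a b. a \<le> b \<Longrightarrow> \<bar>d b - d a\<bar> \<le> (F b - F a) * (b - a)"
    and F: "\<And>x. 0 \<le> F x" "\<And>x. F x \<le> 1" and "a \<le> b"
  shows "d a = d b"
proof (rule ccontr)
  assume "d a \<noteq> d b"
  then have pos: "0 < \<bar>d b - d a\<bar>" by simp
  obtain n :: nat where n: "(b - a) / \<bar>d b - d a\<bar> < real n" using reals_Archimedean2 by blast
  have n0: "0 < real n"
    using n pos \<open>a \<le> b\<close> by (meson divide_nonneg_pos diff_ge_0_iff_ge order.strict_trans1)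
  define p where "p i = a + real i * ((b - a) / real n)" for i :: nat
  have p0: "p 0 = a" and pn: "p n = b"
    using n0 by (simp_all add: p_def)
  have step: "p (Suc i) - p i = (b - a) / n" for i
    using n0 by (simp add: p_def field_simps)
  have le: "p i \<le> p (Suc i)" for i
    using step[of i] \<open>a \<le> b\<close> n0 by (smt (verit) divide_nonneg_pos)
  have "\<bar>d b - d a\<bar> = \<bar>\<Sum>i<n. d (p (Suc i)) - d (p i)\<bar>"
    by (subst sum_lessThan_telescope) (simp add: p0 pn)
  also have "\<dots> \<le> (\<Sum>i<n. \<bar>d (p (Suc i)) - d (p i)\<bar>)"
    by (rule sum_abs)
  also have "\<dots> \<le> (\<Sum>i<n. (F (p (Suc i)) - F (p i)) * ((b - a) / n))"
    by (intro sum_mono) (metis d le step)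
  also have "\<dots> = (F b - F a) * ((b - a) / n)"
    by (subst sum_distrib_right[symmetric], subst sum_lessThan_telescope) (simp add: p0 pn)
  also have "\<dots> \<le> 1 * ((b - a) / n)"
    using F(1)[of a] F(2)[of b] \<open>a \<le> b\<close> n0 by (intro mult_right_mono) auto
  also have "\<dots> < \<bar>d b - d a\<bar>"
    using n n0 pos by (simp add: field_simps)
  finally show False by simp
qed

text \<open>The integrand \<open>min b w - min a w\<close> is squeezed between \<open>b - a\<close>
  times the indicator of \<open>w > b\<close> and \<open>b - a\<close> times the indicator of
  \<open>w > a\<close>.\<close>

lemma min_expectation_increment:
  assumes W: "real_distribution W" and int: "\<And>y. integrable W (\<lambda>w. min y w)" and "a \<le> b"
  shows "(b - a) * (1 - cdf W b) \<le> (\<integral>w. min b w \<partial>W) - (\<integral>w. min a w \<partial>W)"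
    and "(\<integral>w. min b w \<partial>W) - (\<integral>w. min a w \<partial>W) \<le> (b - a) * (1 - cdf W a)"
proof -
  interpret real_distribution W by fact
  have eq: "(\<integral>w. min b w \<partial>W) - (\<integral>w. min a w \<partial>W) = (\<integral>w. min b w - min a w \<partial>W)"
    by (intro Bochner_Integration.integral_diff[symmetric] int)
  have ind: "integrable W (\<lambda>w. (b - a) * (1 - indicator {..x} w))"
      "(\<integral>w. (b - a) * (1 - indicator {..x} w) \<partial>W) = (b - a) * (1 - cdf W x)" for x
    using prob_space by (simp_all add: cdf_def emeasure_eq_measure)
  show "(b - a) * (1 - cdf W b) \<le> (\<integral>w. min b w \<partial>W) - (\<integral>w. min a w \<partial>W)"
    unfolding eq ind(2)[symmetric] using \<open>a \<le> b\<close>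
    by (intro integral_mono ind(1) Bochner_Integration.integrable_diff int)
      (auto simp: indicator_def)
  show "(\<integral>w. min b w \<partial>W) - (\<integral>w. min a w \<partial>W) \<le> (b - a) * (1 - cdf W a)"
    unfolding eq ind(2)[symmetric] using \<open>a \<le> b\<close>
    by (intro integral_mono ind(1) Bochner_Integration.integrable_diff int)
      (auto simp: indicator_def)
qed

lemma surrogate_increment:
  assumes N: "\<And>y. local_cost N y = y - G y" and W: "is_surrogate_cost N W" and "a \<le> b"
  shows "(b - a) * cdf W a \<le> G b - G a" and "G b - G a \<le> (b - a) * cdf W b"
proof -
  have W': "real_distribution W" "integrable W (\<lambda>w. min y w)" "(\<integral>w. min y w \<partial>W) = y - G y" for y
    using W N by (auto simp: is_surrogate_cost_def)
  show "(b - a) * cdf W a \<le> G b - G a" "G b - G a \<le> (b - a) * cdf W b"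
    using min_expectation_increment[OF W'(1,2) \<open>a \<le> b\<close>] by (auto simp: W'(3) algebra_simps)
qed

lemma cdf_le_right_limit:
  assumes "real_distribution W" and "\<delta> > 0" and le: "\<And>h. 0 < h \<Longrightarrow> h < \<delta> \<Longrightarrow> x \<le> cdf W (a + h)"
  shows "x \<le> cdf W a"
proof -
  interpret real_distribution W by fact
  have "((cdf W) \<longlongrightarrow> cdf W a) (at_right a)"
    using cdf_is_right_cont[of a] by (simp add: continuous_within)
  moreover have "\<forall>\<^sub>F t in at_right a. x \<le> cdf W t"
    unfolding eventually_at_right_field
    using le[of "t - a" for t] \<open>\<delta> > 0\<close> by (intro exI[of _ "a + \<delta>"]) (auto simp: field_simps)
  ultimately show ?thesis
    by (intro tendsto_lowerbound[of "cdf W"]) auto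
qed

text \<open>Chord slopes lie between the values of the distribution functions at the end points, so
  \<open>cdf W a \<le> cdf W' (b + h)\<close> for small \<open>h\<close>; right-continuity removes
  \<open>h\<close>.\<close>

lemma surrogate_cdf_le:
  assumes N: "\<And>y. local_cost N y = y - G y" "is_surrogate_cost N W"
    and N': "\<And>y. local_cost N' y = y - G' y" "is_surrogate_cost N' W'"
    and "\<delta> > 0" and le: "\<And>h. 0 < h \<Longrightarrow> h < \<delta> \<Longrightarrow> G (a + h) - G a \<le> G' (b + h) - G' b"
  shows "cdf W a \<le> cdf W' b"
proof (rule cdf_le_right_limit)
  show "real_distribution W'"
    using N'(2) by (simp add: is_surrogate_cost_def)
  fix h assume h: "0 < h" "h < \<delta>"
  have "h * cdf W a \<le> h * cdf W' (b + h)"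
    using surrogate_increment(1)[OF N, of a "a + h"] surrogate_increment(2)[OF N', of b "b + h"] le[OF h] h(1)
    unfolding add_diff_cancel_left' by linarith
  then show "cdf W a \<le> cdf W' (b + h)"
    using h by simp
qed fact

text \<open>The distribution function of the surrogate cost is the right derivative of \<open>G\<close>.\<close>

lemma surrogate_exists:
  assumes N: "\<And>y. local_cost N y = y - G y" and G: "gain_function G"
  shows "\<exists>W. is_surrogate_cost N W"
proof -
  define s where "s a b = (G b - G a) / (b - a)" for a b
  \<comment> \<open>By convexity the slopes decrease as \<open>b\<close> decreases to
    \<open>a\<close>, so this infimum is the right derivative.\<close>
  define F where "F a = (INF b\<in>{a<..}. s a b)" for a
  have s01: "0 \<le> s a b" "s a b \<le> 1" if "a < b" for a b
    using gain_function_mono[OF G, of a b] gain_function_diff_le[OF G, of a b] that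
    by (auto simp: s_def)
  have bdd: "bdd_below (s a ` {a<..})" for a
    using s01 by (intro bdd_belowI2[of _ 0]) auto
  have F_le: "F a \<le> s a b" if "a < b" for a b
    unfolding F_def using that by (intro cINF_lower bdd) auto
  have F_ge: "s a b \<le> F b" if "a < b" for a b
    unfolding F_def using gain_function_slopes[OF G, of a b] that
    by (intro cINF_greatest) (auto simp: s_def intro: order_trans)
  have F01: "0 \<le> F a" "F a \<le> 1" for a
    using order_trans[OF s01(1) F_ge, of "a - 1" a] order_trans[OF F_le s01(2), of a "a + 1"] by simp_all
  have F_mono: "F a \<le> F b" if "a \<le> b" for a b
    using F_le[of a b] F_ge[of a b] that by (cases "a = b") auto
  have F_neg: "F a = 0" if "a < 0" for a
    using F_le[of a 0] F01(1)[of a] gain_function_nonpos[OF G] that by (auto simp: s_def)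
  have bot: "(F \<longlongrightarrow> 0) at_bot"
    using F_neg by (intro tendsto_eventually) (auto simp: eventually_at_bot_dense)
  have top: "(F \<longlongrightarrow> 1) at_top"
  proof -
    obtain C where C: "z - C \<le> G z" for z
      using gain_function_ge[OF G] by blast
    have "\<forall>\<^sub>F z in at_top. 1 - C / z \<le> F z"
      using eventually_gt_at_top[of 0]
    proof eventually_elim
      case (elim z)
      have "1 - C / z \<le> s 0 z"
        using divide_right_mono[OF C[of z], of z] elim gain_function_nonpos[OF G, of 0]
        by (simp add: s_def diff_divide_distrib)
      then show ?case
        using F_ge[OF elim] by simp
    qed
    moreover have "((\<lambda>z. 1 - C / z) \<longlongrightarrow> 1) at_top"
      using tendsto_diff[OF tendsto_const[of 1]
          tendsto_divide_0[OF tendsto_const[of C] filterlim_at_top_imp_at_infinity[OF filterlim_ident]]]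
      by simp
    ultimately show ?thesis
      using F01(2) by (intro tendsto_sandwich[of "\<lambda>z. 1 - C / z" F at_top "\<lambda>_. 1"]) auto
  qed
  have rc: "continuous (at_right a) F" for a
    unfolding continuous_within
  proof (rule order_tendstoI)
    fix e assume "e < F a"
    then show "\<forall>\<^sub>F x in at_right a. e < F x"
      unfolding eventually_at_right_field by (meson F_mono less_le_trans less_imp_le gt_ex)
  next
    fix e assume "F a < e"
    then obtain b where b: "a < b" "s a b < e"
      unfolding F_def by (subst (asm) cINF_less_iff) (auto intro: bdd)
    have "(G \<longlongrightarrow> G a) (at_right a)"
      using gain_function_continuous[OF G, of UNIV]
      by (metis continuous_on_eq_continuous_at continuous_at_imp_continuous_within continuous_within
          open_UNIV UNIV_I)
    then have "((\<lambda>x. s x b) \<longlongrightarrow> s a b) (at_right a)"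
      unfolding s_def using b(1) by (intro tendsto_intros) auto
    then have "\<forall>\<^sub>F x in at_right a. s x b < e"
      using b(2) by (rule order_tendstoD)
    moreover have "\<forall>\<^sub>F x in at_right a. x < b"
      using b(1) by (auto simp: eventually_at_right_field)
    ultimately show "\<forall>\<^sub>F x in at_right a. F x < e"
      by eventually_elim (meson F_le le_less_trans)
  qed
  define W where "W = interval_measure F"
  have W: "real_distribution W" "cdf W = F"
    unfolding W_def using real_distribution_interval_measure[OF F_mono rc bot top]
      cdf_interval_measure[OF F_mono rc bot] by simp_all
  interpret real_distribution W by fact
  \<comment> \<open>A lower bound on the support makes \<open>min y w\<close> bounded almost
    everywhere, and at \<open>y = - 1\<close> both sides of the desired identity are known.\<close>
  have "prob {..- 1} = 0"
    using W(2) F_neg[of "- 1"] by (simp add: cdf_def fun_eq_iff)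
  then have AE: "AE w in W. - 1 < w"
    by (intro AE_I[of _ _ "{..- 1}"]) (auto simp: emeasure_eq_measure)
  have int: "integrable W (\<lambda>w. min y w)" for y
    by (rule integrable_const_bound[of _ "\<bar>y\<bar> + 1"]) (use AE in \<open>auto elim!: eventually_mono\<close>)
  define m where "m y = (\<integral>w. min y w \<partial>W)" for y
  have inc: "(b - a) * (1 - F b) \<le> m b - m a" "m b - m a \<le> (b - a) * (1 - F a)" if "a \<le> b" for a b
    using min_expectation_increment[OF W(1) int that] by (simp_all add: m_def W(2))
  have incG: "(b - a) * F a \<le> G b - G a" "G b - G a \<le> (b - a) * F b" if "a \<le> b" for a b
  proof -
    have "(b - a) * F a \<le> G b - G a \<and> G b - G a \<le> (b - a) * F b"
    proof (cases "a = b")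
      case False
      then have "a < b" using that by simp
      then show ?thesis
        using F_le[of a b] F_ge[of a b] by (simp add: s_def pos_le_divide_eq pos_divide_le_eq mult.commute)
    qed simp
    then show "(b - a) * F a \<le> G b - G a" "G b - G a \<le> (b - a) * F b" by auto
  qed
  \<comment> \<open>The defect of the desired identity. The increments of \<open>y - G y\<close> and
    of \<open>m\<close> obey the same two bounds, so \<open>d\<close> is constant, and it vanishes
    at \<open>- 1\<close>.\<close>
  define d where "d y = y - G y - m y" for y
  have "m (-1) = (\<integral>w. - 1 \<partial>W)"
    unfolding m_def by (intro integral_cong_AE) (use AE in \<open>auto elim!: eventually_mono\<close>)
  then have "d (-1) = 0"
    using gain_function_nonpos[OF G] prob_space by (simp add: d_def)
  moreover have "d a = d b" if "a \<le> b" for a b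
  proof (rule const_of_mono_bound[OF _ F01 that])
    fix a b :: real assume ab: "a \<le> b"
    define A B where "A = (b - a) * F a" and "B = (b - a) * F b"
    have "(b - a) * (1 - F a) = (b - a) - A" "(b - a) * (1 - F b) = (b - a) - B"
      "(F b - F a) * (b - a) = B - A"
      unfolding A_def B_def by algebra+
    note eqs = this
    show "\<bar>d b - d a\<bar> \<le> (F b - F a) * (b - a)"
      using inc[OF ab] incG[OF ab] unfolding eqs d_def A_def[symmetric] B_def[symmetric]
      by (intro abs_leI) linarith+
  qed
  ultimately have "d y = 0" for y
    using linear[of y "- 1"] by metis
  then show ?thesis
    using W(1) int by (intro exI[of _ W]) (auto simp: is_surrogate_cost_def d_def m_def N)
qed

text \<open>The definite description needs uniqueness: comparing the increments of \<open>G\<close>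
  with themselves shows that any two candidate laws have the same distribution function.\<close>

lemma surrogate_cost:
  assumes N: "\<And>y. local_cost N y = y - G y" and G: "gain_function G"
  shows "is_surrogate_cost N (surrogate_cost N)"
proof -
  obtain W where W: "is_surrogate_cost N W"
    using surrogate_exists[OF assms] by blast
  have le: "cdf V y \<le> cdf U y" if "is_surrogate_cost N V" "is_surrogate_cost N U" for U V y
    using surrogate_cdf_le[OF N that(1) N that(2), of 1 y y] by simp
  have "U = W" if "is_surrogate_cost N U" for U
    using le[OF W that] le[OF that W] W that
    by (intro cdf_unique) (auto simp: is_surrogate_cost_def fun_eq_iff intro: order_antisym)
  with W show ?thesis
    unfolding surrogate_cost_def by (rule theI)
qed

lemma quantile_scale_le:
  assumes "0 < \<alpha>" and le: "\<And>y. cdf Z y \<le> cdf Z' (\<alpha> * y)"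
  shows "quantile Z' q \<le> ereal \<alpha> * quantile Z q"
proof -
  have "quantile Z' q / ereal \<alpha> \<le> quantile Z q"
    unfolding quantile_def[of Z]
  proof (rule INF_greatest)
    fix x assume "x \<in> {x. q \<le> cdf Z x}"
    then have "quantile Z' q \<le> ereal (\<alpha> * x)"
      unfolding quantile_def using le[of x] by (intro INF_lower) simp
    then show "quantile Z' q / ereal \<alpha> \<le> ereal x"
      using \<open>0 < \<alpha>\<close> by (simp add: ereal_divide_le_pos)
  qed
  then show ?thesis
    using \<open>0 < \<alpha>\<close> by (simp add: ereal_divide_le_pos)
qed

subsection \<open>Optimality equations for local games\<close>

text \<open>A verification principle. The inequalities bound the cost of every policy from below by
  \<open>F\<close>, by induction on the decision tree; \<open>attained\<close> with the decreasing
  rank \<open>r\<close> builds a policy of cost exactly \<open>F\<close>. The invariant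
  \<open>S\<close> contains all reachable states.\<close>

lemma local_cost_eqI:
  assumes init: "init N \<in> S"
    and closed: "\<And>s a s'. s \<in> S \<Longrightarrow> a \<in> avail N s \<Longrightarrow> s' \<in> set_pmf (trans N s a) \<Longrightarrow> s' \<in> S"
    and fin: "\<And>s a. s \<in> S \<Longrightarrow> a \<in> avail N s \<Longrightarrow> finite (set_pmf (trans N s a))"
    and outside: "\<And>s. s \<in> S \<Longrightarrow> F s \<le> y"
    and terminal: "\<And>s. s \<in> S \<Longrightarrow> s \<in> terminal N \<Longrightarrow> F s \<le> val N s"
    and advance: "\<And>s a. s \<in> S \<Longrightarrow> a \<in> avail N s \<Longrightarrow>
      F s \<le> act_cost N s a + measure_pmf.expectation (trans N s a) F"
    and attained: "\<And>s. s \<in> S \<Longrightarrow> F s = y \<or> (s \<in> terminal N \<and> F s = val N s) \<or>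
      (\<exists>a\<in>avail N s. F s = act_cost N s a + measure_pmf.expectation (trans N s a) F \<and>
         (\<forall>s'\<in>set_pmf (trans N s a). r s' < (r s :: nat)))"
  shows "local_cost N y = F (init N)"
proof -
  have lower: "F s \<le> expected_cost N y P s" if "feasible N P s" "s \<in> S" for P s
    using that
  proof (induction P arbitrary: s)
    case (Advance a P)
    have "measure_pmf.expectation (trans N s a) F
        \<le> measure_pmf.expectation (trans N s a) (\<lambda>s'. expected_cost N y (P s') s')"
      using Advance closed fin
      by (intro integral_mono_AE integrable_measure_pmf_finite) (auto simp: AE_measure_pmf_iff)
    then show ?case
      using advance[of s a] Advance.prems by simp
  next
    case (Mix p A B)
    have "F s = p * F s + (1 - p) * F s" by (simp add: algebra_simps)
    also have "\<dots> \<le> p * expected_cost N y A s + (1 - p) * expected_cost N y B s"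
      using Mix by (intro add_mono mult_left_mono) auto
    finally show ?case by simp
  qed (use outside terminal in auto)
  have upper: "\<exists>P. feasible N P s \<and> expected_cost N y P s = F s" if "s \<in> S" for s
    using that
  proof (induction s rule: measure_induct_rule[of r])
    case (less s)
    consider "F s = y" | "s \<in> terminal N" "F s = val N s"
      | a where "a \<in> avail N s" "F s = act_cost N s a + measure_pmf.expectation (trans N s a) F"
          "\<forall>s'\<in>set_pmf (trans N s a). r s' < r s"
      using attained[OF less.prems] by blast
    then show ?case
    proof cases
      case 1
      then show ?thesis by (intro exI[of _ Accept_Outside]) simp
    next
      case 2
      then show ?thesis by (intro exI[of _ Accept_Terminal]) simp
    next
      case (3 a)
      have "\<forall>s'\<in>set_pmf (trans N s a). \<exists>P. feasible N P s' \<and> expected_cost N y P s' = F s'"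
        using less 3 closed by blast
      then obtain P where P: "\<And>s'. s' \<in> set_pmf (trans N s a) \<Longrightarrow>
          feasible N (P s') s' \<and> expected_cost N y (P s') s' = F s'"
        by metis
      have "measure_pmf.expectation (trans N s a) (\<lambda>s'. expected_cost N y (P s') s')
          = measure_pmf.expectation (trans N s a) F"
        using P by (intro integral_cong_AE) (auto simp: AE_measure_pmf_iff)
      then show ?thesis
        using 3 P by (intro exI[of _ "Advance a P"]) simp
    qed
  qed
  obtain P where "feasible N P (init N)" "expected_cost N y P (init N) = F (init N)"
    using upper[OF init] by blast
  then show ?thesis
    unfolding local_cost_def using lower init by (intro cInf_eq_minimum) force+
qed

subsection \<open>Gains of additive boxes\<close>

lemma gain_function_max_zero: "gain_function (\<lambda>z. max 0 z)"
proof -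
  have "convex_on UNIV (\<lambda>z::real. max 0 z)"
  proof (rule convex_onI)
    fix t x y :: real assume t: "0 < t" "t < 1"
    have "(1 - t) * x \<le> (1 - t) * max 0 x" "t * y \<le> t * max 0 y"
      "0 \<le> (1 - t) * max 0 x" "0 \<le> t * max 0 y"
      using t by (auto intro!: mult_left_mono mult_nonneg_nonneg)
    then show "max 0 ((1 - t) *\<^sub>R x + t *\<^sub>R y) \<le> (1 - t) * max 0 x + t * max 0 y"
      by simp
  qed simp
  then show ?thesis
    unfolding gain_function_def by (auto intro!: exI[of _ 0])
qed

lemma gain_function_max:
  assumes G: "gain_function G" and H: "gain_function H"
  shows "gain_function (\<lambda>z. max (G z) (H z))"
proof -
  have "convex_on UNIV (\<lambda>z. max (G z) (H z))"
  proof (rule convex_onI)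
    fix t x y :: real assume t: "0 < t" "t < 1"
    have "G ((1 - t) *\<^sub>R x + t *\<^sub>R y) \<le> (1 - t) * G x + t * G y"
      "H ((1 - t) *\<^sub>R x + t *\<^sub>R y) \<le> (1 - t) * H x + t * H y"
      using t by (intro convex_onD[OF gain_function_convex] G H; simp)+
    moreover have "(1 - t) * G x \<le> (1 - t) * max (G x) (H x)" "t * G y \<le> t * max (G y) (H y)"
      "(1 - t) * H x \<le> (1 - t) * max (G x) (H x)" "t * H y \<le> t * max (G y) (H y)"
      using t by (auto intro!: mult_left_mono)
    ultimately show "max (G ((1 - t) *\<^sub>R x + t *\<^sub>R y)) (H ((1 - t) *\<^sub>R x + t *\<^sub>R y))
        \<le> (1 - t) * max (G x) (H x) + t * max (G y) (H y)"
      by simp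
  qed simp
  moreover have "\<exists>C. \<forall>z. z - C \<le> max (G z) (H z)"
    using gain_function_ge[OF G] by (meson max.coboundedI1)
  moreover have "max (G w) (H w) \<le> max (G z) (H z)" "max (G z) (H z) - max (G w) (H w) \<le> z - w"
    if "w \<le> z" for w z
    using gain_function_mono[OF G that] gain_function_mono[OF H that]
      gain_function_diff_le[OF G that] gain_function_diff_le[OF H that] by auto
  ultimately show ?thesis
    unfolding gain_function_def using gain_function_nonpos[OF G] gain_function_nonpos[OF H] by auto
qed

lemma gain_function_Max:
  assumes "finite A" "A \<noteq> {}" "\<And>a. a \<in> A \<Longrightarrow> gain_function (f a)"
  shows "gain_function (\<lambda>z. MAX a\<in>A. f a z)"
  using assms
proof (induction A rule: finite_ne_induct)
  case (insert a A)
  then show ?case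
    using gain_function_max[of "f a" "\<lambda>z. MAX a\<in>A. f a z"] by simp
qed simp

locale additive_components =
  fixes k :: nat and D :: "nat \<Rightarrow> real pmf" and c :: "nat \<Rightarrow> real"
  assumes box: "additive_box k D c"
begin

abbreviation expect :: "nat \<Rightarrow> (real \<Rightarrow> real) \<Rightarrow> real" where
  "expect j f \<equiv> measure_pmf.expectation (D j) f"

lemma component:
  assumes "j < k"
  shows "finite (set_pmf (D j))" "v \<in> set_pmf (D j) \<Longrightarrow> 0 \<le> v" "0 \<le> c j"
  using box assms by (auto simp: additive_box_def)

lemma integrable_component: "j < k \<Longrightarrow> integrable (D j) (f :: real \<Rightarrow> real)"
  by (intro integrable_measure_pmf_finite component)

lemma expect_mono:
  "j < k \<Longrightarrow> (\<And>v. v \<in> set_pmf (D j) \<Longrightarrow> f v \<le> g v) \<Longrightarrow> expect j f \<le> expect j g"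
  by (intro integral_mono_AE integrable_component) (auto simp: AE_measure_pmf_iff)

lemma expect_cong:
  "(\<And>v. v \<in> set_pmf (D j) \<Longrightarrow> f v = g v) \<Longrightarrow> expect j f = expect j g"
  by (intro integral_cong_AE) (auto simp: AE_measure_pmf_iff)

lemma expect_diff: "j < k \<Longrightarrow> expect j (\<lambda>v. f v - g v) = expect j f - expect j g"
  by (intro Bochner_Integration.integral_diff integrable_component)

lemma expect_add: "j < k \<Longrightarrow> expect j (\<lambda>v. f v + g v) = expect j f + expect j g"
  by (intro Bochner_Integration.integral_add integrable_component)

lemma expect_swap:
  assumes "i < k" "j < k"
  shows "expect i (\<lambda>u. expect j (f u)) = expect j (\<lambda>v. expect i (\<lambda>u. f u v))"
proof -
  have sum: "expect l g = (\<Sum>v\<in>set_pmf (D l). g v * pmf (D l) v)" if "l < k" for l g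
    using component(1)[OF that] by (intro integral_measure_pmf_real) auto
  show ?thesis
    unfolding sum[OF assms(1)] sum[OF assms(2)] sum_distrib_right
    by (subst sum.swap) (simp add: mult_ac)
qed

text \<open>Here \<open>z\<close> is the outside option minus the values seen so far, and
  \<open>G\<close> is the gain from the components left after \<open>j\<close>. The maximum with 0
  is the choice of the outside option.\<close>

definition probe_gain :: "nat \<Rightarrow> (real \<Rightarrow> real) \<Rightarrow> real \<Rightarrow> real" where
  "probe_gain j G z = max 0 (expect j (\<lambda>v. G (z - v)) - c j)"

lemma gain_function_probe:
  assumes j: "j < k" and G: "gain_function G"
  shows "gain_function (probe_gain j G)"
proof -
  let ?E = "\<lambda>z. expect j (\<lambda>v. G (z - v))"
  have nonpos: "probe_gain j G z = 0" if "z \<le> 0" for z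
  proof -
    have "?E z = expect j (\<lambda>v. 0)"
      using component(2)[OF j] that by (intro expect_cong gain_function_nonpos[OF G]) force
    then show ?thesis
      using component(3)[OF j] by (simp add: probe_gain_def)
  qed
  have mono: "?E w \<le> ?E z" and lip: "?E z - ?E w \<le> z - w" if "w \<le> z" for w z
  proof -
    show "?E w \<le> ?E z"
      using that by (intro expect_mono j gain_function_mono[OF G]) simp
    have "?E z - ?E w = expect j (\<lambda>v. G (z - v) - G (w - v))"
      using j by (simp add: expect_diff)
    also have "\<dots> \<le> expect j (\<lambda>v. z - w)"
      using that gain_function_diff_le[OF G, of "w - v" "z - v" for v] by (intro expect_mono j) simp
    finally show "?E z - ?E w \<le> z - w" by simp
  qed
  have convex: "convex_on UNIV (probe_gain j G)"
  proof (rule convex_onI)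
    fix t x y :: real assume t: "0 < t" "t < 1"
    let ?z = "(1 - t) *\<^sub>R x + t *\<^sub>R y"
    have "?E ?z \<le> expect j (\<lambda>v. (1 - t) * G (x - v) + t * G (y - v))"
    proof (intro expect_mono j)
      fix v
      have "?z - v = (1 - t) *\<^sub>R (x - v) + t *\<^sub>R (y - v)" by (simp add: algebra_simps)
      then show "G (?z - v) \<le> (1 - t) * G (x - v) + t * G (y - v)"
        using convex_onD[OF gain_function_convex[OF G], of t "x - v" "y - v"] t by simp
    qed
    also have "\<dots> = (1 - t) * ?E x + t * ?E y"
      using j by (simp add: expect_add)
    finally have le: "?E ?z - c j \<le> (1 - t) * (?E x - c j) + t * (?E y - c j)"
      by (simp add: algebra_simps)
    show "probe_gain j G ?z \<le> (1 - t) * probe_gain j G x + t * probe_gain j G y"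
      unfolding probe_gain_def[of j G ?z]
    proof (rule max.boundedI)
      show "0 \<le> (1 - t) * probe_gain j G x + t * probe_gain j G y"
        using t by (simp add: probe_gain_def)
      show "?E ?z - c j \<le> (1 - t) * probe_gain j G x + t * probe_gain j G y"
        using t by (intro order_trans[OF le] add_mono mult_left_mono) (simp_all add: probe_gain_def)
    qed
  qed simp
  have incr: "probe_gain j G w \<le> probe_gain j G z \<and> probe_gain j G z - probe_gain j G w \<le> z - w"
    if "w \<le> z" for w z
  proof -
    have "max 0 (a - d) \<le> max 0 (b - d) \<and> max 0 (b - d) - max 0 (a - d) \<le> z - w"
      if "a \<le> b" "b - a \<le> z - w" for a b d :: real
      using that by (simp add: max_def)
    from this[OF mono[OF that] lip[OF that]] show ?thesis
      unfolding probe_gain_def .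
  qed
  obtain C where C: "z - C \<le> G z" for z
    using gain_function_ge[OF G] by blast
  \<comment> \<open>One probe raises the bound on \<open>z - G z\<close> by at most the mean of the
    component plus its cost.\<close>
  have ge: "z - (C + expect j (\<lambda>v. v) + c j) \<le> probe_gain j G z" for z
  proof -
    have "z - C - expect j (\<lambda>v. v) = expect j (\<lambda>v. (z - C) - v)"
      using j by (simp add: expect_diff)
    also have "\<dots> \<le> ?E z"
    proof (rule expect_mono[OF j])
      show "z - C - v \<le> G (z - v)" for v
        using C[of "z - v"] by simp
    qed
    finally show ?thesis
      by (simp add: probe_gain_def)
  qed
  show ?thesis
    unfolding gain_function_def
  proof (intro conjI)
    show "\<forall>z\<le>0. probe_gain j G z = 0"
      by (intro allI impI nonpos)
    show "\<forall>w z. w \<le> z \<longrightarrow> probe_gain j G w \<le> probe_gain j G z \<and> probe_gain j G z - probe_gain j G w \<le> z - w"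
      by (intro allI impI incr)
    show "\<exists>C. \<forall>z. z - C \<le> probe_gain j G z"
      by (intro exI allI) (rule ge)
  qed (rule convex)
qed

primrec static_gain :: "nat list \<Rightarrow> real \<Rightarrow> real" where
  "static_gain [] = (\<lambda>z. max 0 z)"
| "static_gain (j # \<sigma>) = probe_gain j (static_gain \<sigma>)"

text \<open>The first argument of \<open>opt_gain\<close> is the fuel \<open>card T\<close>.\<close>

primrec opt_gain :: "nat \<Rightarrow> nat set \<Rightarrow> real \<Rightarrow> real" where
  "opt_gain 0 T = (\<lambda>z. max 0 z)"
| "opt_gain (Suc n) T = (\<lambda>z. MAX j\<in>T. probe_gain j (opt_gain n (T - {j})) z)"

lemma gain_function_static: "set \<sigma> \<subseteq> {..<k} \<Longrightarrow> gain_function (static_gain \<sigma>)"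
  by (induction \<sigma>) (auto intro: gain_function_max_zero gain_function_probe)

lemma gain_function_opt: "T \<subseteq> {..<k} \<Longrightarrow> card T = n \<Longrightarrow> gain_function (opt_gain n T)"
proof (induction n arbitrary: T)
  case (Suc n)
  have "finite T" "T \<noteq> {}" using Suc.prems finite_subset by auto
  moreover have "gain_function (probe_gain j (opt_gain n (T - {j})))" if "j \<in> T" for j
    using Suc that \<open>finite T\<close> by (intro gain_function_probe Suc.IH) auto
  ultimately show ?case
    by (auto intro!: gain_function_Max)
qed (simp add: gain_function_max_zero)

text \<open>Extends the terminal value to partially probed states, where \<open>val\<close> would
  apply \<open>the\<close> to \<open>None\<close>.\<close>

definition total :: "(nat \<rightharpoonup> real) \<Rightarrow> real" where
  "total s = (\<Sum>j\<in>dom s. the (s j))"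

lemma total_upd: "finite (dom s) \<Longrightarrow> j \<notin> dom s \<Longrightarrow> total (s(j \<mapsto> v)) = total s + v"
proof -
  assume "finite (dom s)" "j \<notin> dom s"
  moreover have "(\<Sum>i\<in>dom s. the ((s(j \<mapsto> v)) i)) = (\<Sum>i\<in>dom s. the (s i))"
    using \<open>j \<notin> dom s\<close> by (intro sum.cong) auto
  ultimately show ?thesis
    by (simp add: total_def)
qed

lemma probe_expectation:
  assumes "j < k" "finite (dom s)" "j \<notin> dom s"
  shows "measure_pmf.expectation (map_pmf (\<lambda>v. s(j \<mapsto> v)) (D j)) (\<lambda>s'. y - H s' (y - total s'))
    = y - expect j (\<lambda>v. H (s(j \<mapsto> v)) (y - total s - v))"
  using assms by (simp add: total_upd expect_diff diff_diff_eq del: fun_upd_apply)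

text \<open>The gain available in a state depends only on the unprobed components and the budget
  \<open>y - total s\<close>. The resulting value function passes the verification principle, with
  the number of unprobed components as rank.\<close>

lemma local_cost_additive:
  "local_cost (additive_mdp k D c) y = y - opt_gain k {..<k} y"
proof -
  let ?M = "additive_mdp k D c" and ?S = "{s :: nat \<rightharpoonup> real. dom s \<subseteq> {..<k}}"
  define R where "R s = {..<k} - dom s" for s :: "nat \<rightharpoonup> real"
  define H where "H s = opt_gain (card (R s)) (R s)" for s
  define F where "F s = y - H s (y - total s)" for s
  have fin: "finite (dom s)" if "s \<in> ?S" for s
    using that finite_subset by auto
  have finR: "finite (R s)" for s
    by (simp add: R_def)
  have H0: "H s z = max 0 z" if "R s = {}" for s z
    using that by (simp add: H_def)
  have H_step: "H s z = (MAX j\<in>R s. probe_gain j (opt_gain (card (R s) - 1) (R s - {j})) z)"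
    if "R s \<noteq> {}" for s z
  proof -
    have "card (R s) \<noteq> 0"
      using that finR[of s] by simp
    then obtain n where "card (R s) = Suc n"
      using not0_implies_Suc by blast
    then show ?thesis
      unfolding H_def by simp
  qed
  have F_probe: "measure_pmf.expectation (map_pmf (\<lambda>v. s(j \<mapsto> v)) (D j)) F
      = y - expect j (\<lambda>v. opt_gain (card (R s) - 1) (R s - {j}) (y - total s - v))"
    if "s \<in> ?S" "j \<in> R s" for s j
  proof -
    have j: "j < k" "j \<notin> dom s"
      using that(2) by (auto simp: R_def)
    have R_upd: "R (s(j \<mapsto> v)) = R s - {j}" for v
      by (auto simp: R_def)
    have "H (s(j \<mapsto> v)) = opt_gain (card (R s) - 1) (R s - {j})" for v
      unfolding H_def R_upd card_Diff_singleton[OF that(2)] ..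
    moreover have "F = (\<lambda>s'. y - H s' (y - total s'))"
      by (simp add: F_def fun_eq_iff)
    ultimately show ?thesis
      using probe_expectation[OF j(1) fin[OF that(1)] j(2), of y H] by (simp only:)
  qed
  have full: "val ?M s = total s" if "dom s = {..<k}" for s
    using that by (simp add: additive_mdp_def total_def)
  have "local_cost ?M y = F (init ?M)"
  proof (rule local_cost_eqI[where S = ?S and r = "\<lambda>s. card (R s)"])
    fix s :: "nat \<rightharpoonup> real" assume s: "s \<in> ?S"
    have "gain_function (H s)"
      unfolding H_def by (rule gain_function_opt) (auto simp: R_def)
    from gain_function_nonneg[OF this] show "F s \<le> y"
      by (simp add: F_def)
    show "F s \<le> val ?M s" if "s \<in> terminal ?M"
      using that full[of s] by (simp add: F_def H0 R_def additive_mdp_def)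
    fix j assume j: "j \<in> avail ?M s"
    then have jR: "j \<in> R s" by (simp add: R_def additive_mdp_def)
    show "finite (set_pmf (trans ?M s j))"
      using jR component(1)[of j] by (simp add: additive_mdp_def R_def)
    show "s' \<in> ?S" if s': "s' \<in> set_pmf (trans ?M s j)" for s'
    proof -
      obtain v where "s' = s(j \<mapsto> v)"
        using s' by (auto simp: additive_mdp_def)
      then show ?thesis
        using s jR by (simp add: R_def)
    qed
    have "probe_gain j (opt_gain (card (R s) - 1) (R s - {j})) (y - total s) \<le> H s (y - total s)"
      using jR finR[of s] by (subst H_step) auto
    then show "F s \<le> act_cost ?M s j + measure_pmf.expectation (trans ?M s j) F"
      using F_probe[OF s jR] by (simp add: additive_mdp_def F_def probe_gain_def)
  next
    fix s :: "nat \<rightharpoonup> real" assume s: "s \<in> ?S"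
    show "F s = y \<or> (s \<in> terminal ?M \<and> F s = val ?M s) \<or>
      (\<exists>j\<in>avail ?M s. F s = act_cost ?M s j + measure_pmf.expectation (trans ?M s j) F \<and>
        (\<forall>s'\<in>set_pmf (trans ?M s j). card (R s') < card (R s)))"
    proof (cases "R s = {}")
      case True
      then have "dom s = {..<k}" using s by (auto simp: R_def)
      then show ?thesis
        using full[of s] True by (auto simp: F_def H0 additive_mdp_def max_def)
    next
      case False
      let ?p = "\<lambda>j. probe_gain j (opt_gain (card (R s) - 1) (R s - {j})) (y - total s)"
      have "Max (?p ` R s) \<in> ?p ` R s"
        using False finR[of s] by (intro Max_in) auto
      then obtain j where j: "j \<in> R s" "H s (y - total s) = ?p j"
        using H_step[OF False] by auto
      have "card (R (s(j \<mapsto> v))) < card (R s)" for v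
        using j(1) by (intro psubset_card_mono finR) (auto simp: R_def)
      then have "\<forall>s'\<in>set_pmf (trans ?M s j). card (R s') < card (R s)"
        by (auto simp: additive_mdp_def)
      moreover have "F s = y \<or> F s = act_cost ?M s j + measure_pmf.expectation (trans ?M s j) F"
        using F_probe[OF s j(1)] unfolding F_def[of s] j(2) probe_gain_def
        by (simp add: additive_mdp_def max_def)
      moreover have "j \<in> avail ?M s"
        using j(1) by (simp add: additive_mdp_def R_def)
      ultimately show ?thesis by blast
    qed
  qed (simp add: additive_mdp_def)
  also have "\<dots> = y - opt_gain k {..<k} y"
    by (simp add: F_def H_def R_def total_def additive_mdp_def)
  finally show ?thesis .
qed

text \<open>Exposes the order that \<open>static_commitment\<close> hides behind an existential
  quantifier.\<close>

definition static_order :: "nat list \<Rightarrow> ((nat \<rightharpoonup> real) \<Rightarrow> nat pmf) \<Rightarrow> bool" where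
  "static_order \<sigma> \<pi> \<longleftrightarrow> distinct \<sigma> \<and> set \<sigma> = {..<k} \<and>
     (\<forall>i<k. \<forall>s. dom s = set (take i \<sigma>) \<longrightarrow> \<pi> s = return_pmf (\<sigma> ! i))"

lemma static_commitment_iff:
  "static_commitment k D c \<pi> \<longleftrightarrow>
     is_commitment (additive_mdp k D c) \<pi> \<and> (\<exists>\<sigma>. static_order \<sigma> \<pi>)"
  by (simp add: static_commitment_def static_order_def)

lemma static_commitment_exists:
  assumes "distinct \<sigma>" "set \<sigma> = {..<k}"
  obtains \<pi> where "static_commitment k D c \<pi>" "static_order \<sigma> \<pi>"
proof
  \<comment> \<open>Probing the first unprobed component of \<open>\<sigma>\<close> is legal also in
    states whose domain is no prefix, as a commitment requires.\<close>
  define \<pi> where "\<pi> s = return_pmf (hd (filter (\<lambda>j. j \<notin> dom s) \<sigma>))" for s :: "nat \<rightharpoonup> real"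
  have len: "length \<sigma> = k"
    using assms distinct_card[of \<sigma>] by simp
  have "hd (filter (\<lambda>j. j \<notin> set (take i \<sigma>)) \<sigma>) = \<sigma> ! i" if "i < k" for i
  proof -
    have "filter (\<lambda>j. j \<notin> set (take i \<sigma>)) \<sigma> = filter (\<lambda>j. j \<notin> set (take i \<sigma>)) (take i \<sigma> @ drop i \<sigma>)"
      by simp
    also have "\<dots> = drop i \<sigma>"
      unfolding filter_append using set_take_disj_set_drop_if_distinct[OF assms(1), of i i]
      by (auto simp: filter_id_conv)
    finally show ?thesis
      using that len by (simp add: hd_drop_conv_nth)
  qed
  then show order: "static_order \<sigma> \<pi>"
    using assms by (simp add: static_order_def \<pi>_def)
  have "is_commitment (additive_mdp k D c) \<pi>"
    unfolding is_commitment_def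
  proof (intro allI impI)
    fix s :: "nat \<rightharpoonup> real" assume "avail (additive_mdp k D c) s \<noteq> {}"
    then have "filter (\<lambda>j. j \<notin> dom s) \<sigma> \<noteq> []"
      using assms(2) by (auto simp: additive_mdp_def filter_empty_conv)
    from hd_in_set[OF this] show "set_pmf (\<pi> s) \<subseteq> avail (additive_mdp k D c) s"
      using assms(2) by (auto simp: additive_mdp_def \<pi>_def)
  qed
  with order show "static_commitment k D c \<pi>"
    by (auto simp: static_commitment_iff)
qed

text \<open>Every reachable state has a prefix of \<open>\<sigma>\<close> as its domain, so
  \<open>card (dom s)\<close> determines the suffix still to be probed. Elsewhere
  \<open>\<pi>\<close> is unconstrained, hence this choice of invariant.\<close>

lemma local_cost_static:
  assumes "static_order \<sigma> \<pi>"
  shows "local_cost (chain (additive_mdp k D c) \<pi>) y = y - static_gain \<sigma> y"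
proof -
  let ?C = "chain (additive_mdp k D c) \<pi>" and ?S = "{s :: nat \<rightharpoonup> real. \<exists>i\<le>k. dom s = set (take i \<sigma>)}"
  define F where "F s = y - static_gain (drop (card (dom s)) \<sigma>) (y - total s)" for s
  have \<sigma>: "distinct \<sigma>" "set \<sigma> = {..<k}" "length \<sigma> = k"
      "\<And>i s. i < k \<Longrightarrow> dom s = set (take i \<sigma>) \<Longrightarrow> \<pi> s = return_pmf (\<sigma> ! i)"
    using assms distinct_card[of \<sigma>] by (auto simp: static_order_def)
  have card: "card (set (take i \<sigma>)) = i" if "i \<le> k" for i
    using that \<sigma> distinct_card[of "take i \<sigma>"] by simp
  have avail: "avail ?C s = (if {..<k} \<subseteq> dom s then {} else {()})" for s
    by (auto simp: chain_def additive_mdp_def)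
  have step: "\<exists>i<k. dom s = set (take i \<sigma>) \<and> \<sigma> ! i < k \<and> \<sigma> ! i \<notin> dom s \<and>
      trans ?C s () = map_pmf (\<lambda>v. s(\<sigma> ! i \<mapsto> v)) (D (\<sigma> ! i)) \<and>
      (\<forall>v. dom (s(\<sigma> ! i \<mapsto> v)) = set (take (Suc i) \<sigma>)) \<and>
      F s = y - probe_gain (\<sigma> ! i) (static_gain (drop (Suc i) \<sigma>)) (y - total s) \<and>
      act_cost ?C s () + measure_pmf.expectation (trans ?C s ()) F =
        y - (expect (\<sigma> ! i) (\<lambda>v. static_gain (drop (Suc i) \<sigma>) (y - total s - v)) - c (\<sigma> ! i))"
    if s: "s \<in> ?S" and "avail ?C s \<noteq> {}" for s
  proof -
    obtain i where i: "i \<le> k" "dom s = set (take i \<sigma>)" using s by blast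
    with that(2) have ik: "i < k"
      using \<sigma>(2,3) by (cases "i = k") (auto simp: avail)
    have j: "\<sigma> ! i < k" "\<sigma> ! i \<notin> dom s"
      using ik \<sigma> i(2) nth_mem[of i \<sigma>] by (auto simp: in_set_conv_nth nth_eq_iff_index_eq)
    have dom: "dom (s(\<sigma> ! i \<mapsto> v)) = set (take (Suc i) \<sigma>)" for v
      using ik \<sigma>(3) i(2) by (simp add: take_Suc_conv_app_nth)
    have tr: "trans ?C s () = map_pmf (\<lambda>v. s(\<sigma> ! i \<mapsto> v)) (D (\<sigma> ! i))"
      and cost: "act_cost ?C s () = c (\<sigma> ! i)"
      using \<sigma>(4)[OF ik i(2)] by (simp_all add: chain_def additive_mdp_def bind_return_pmf)
    have "measure_pmf.expectation (trans ?C s ()) F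
        = y - expect (\<sigma> ! i) (\<lambda>v. static_gain (drop (Suc i) \<sigma>) (y - total s - v))"
      using probe_expectation[of "\<sigma> ! i" s y "\<lambda>s. static_gain (drop (card (dom s)) \<sigma>)"] j i(2)
        card[of "Suc i"] ik unfolding tr F_def by (simp add: dom del: dom_fun_upd)
    moreover have "F s = y - probe_gain (\<sigma> ! i) (static_gain (drop (Suc i) \<sigma>)) (y - total s)"
      using ik \<sigma>(3) card[of i] i by (simp add: F_def Cons_nth_drop_Suc[symmetric])
    ultimately show ?thesis
      using ik i(2) j dom tr cost by (intro exI[of _ i]) simp
  qed
  have full: "val ?C s = total s" if "dom s = {..<k}" for s
    using that by (simp add: chain_def additive_mdp_def total_def)
  have F_full: "F s = y - max 0 (y - total s)" if "dom s = {..<k}" for s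
    using that \<sigma>(3) by (simp add: F_def)
  have "local_cost ?C y = F (init ?C)"
  proof (rule local_cost_eqI[where S = ?S and r = "\<lambda>s. k - card (dom s)"])
    show "init ?C \<in> ?S" by (auto simp: chain_def additive_mdp_def intro!: exI[of _ 0])
    fix s :: "nat \<rightharpoonup> real" assume s: "s \<in> ?S"
    have "gain_function (static_gain (drop (card (dom s)) \<sigma>))"
      using set_drop_subset[of "card (dom s)" \<sigma>] \<sigma>(2) by (intro gain_function_static) auto
    from gain_function_nonneg[OF this] show "F s \<le> y"
      by (simp add: F_def)
    show "F s \<le> val ?C s" if "s \<in> terminal ?C"
      using that full[of s] F_full[of s] by (simp add: chain_def additive_mdp_def)
    fix a assume a: "a \<in> avail ?C s"
    then obtain i where i: "i < k" "\<sigma> ! i < k" "trans ?C s () = map_pmf (\<lambda>v. s(\<sigma> ! i \<mapsto> v)) (D (\<sigma> ! i))"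
      "\<And>v. dom (s(\<sigma> ! i \<mapsto> v)) = set (take (Suc i) \<sigma>)"
      "F s = y - probe_gain (\<sigma> ! i) (static_gain (drop (Suc i) \<sigma>)) (y - total s)"
      "act_cost ?C s () + measure_pmf.expectation (trans ?C s ()) F =
        y - (expect (\<sigma> ! i) (\<lambda>v. static_gain (drop (Suc i) \<sigma>) (y - total s - v)) - c (\<sigma> ! i))"
      using step[OF s] by blast
    show "finite (set_pmf (trans ?C s a))"
      using i(2,3) component(1) by simp
    show "s' \<in> ?S" if "s' \<in> set_pmf (trans ?C s a)" for s'
      using that i(1,3,4) by (auto intro!: exI[of _ "Suc i"] simp del: dom_fun_upd)
    show "F s \<le> act_cost ?C s a + measure_pmf.expectation (trans ?C s a) F"
      using i(5,6) by (simp add: probe_gain_def)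
  next
    fix s :: "nat \<rightharpoonup> real" assume s: "s \<in> ?S"
    show "F s = y \<or> (s \<in> terminal ?C \<and> F s = val ?C s) \<or>
      (\<exists>a\<in>avail ?C s. F s = act_cost ?C s a + measure_pmf.expectation (trans ?C s a) F \<and>
        (\<forall>s'\<in>set_pmf (trans ?C s a). k - card (dom s') < k - card (dom s)))"
    proof (cases "avail ?C s = {}")
      case True
      have "dom s = {..<k}"
        using s True \<sigma>(2) by (auto simp: avail split: if_splits dest: in_set_takeD)
      then show ?thesis
        using full[of s] F_full[of s] by (auto simp: chain_def additive_mdp_def max_def)
    next
      case False
      then have a: "() \<in> avail ?C s" by (auto simp: avail split: if_splits)
      obtain i where i: "i < k" "dom s = set (take i \<sigma>)"
        "trans ?C s () = map_pmf (\<lambda>v. s(\<sigma> ! i \<mapsto> v)) (D (\<sigma> ! i))"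
        "\<And>v. dom (s(\<sigma> ! i \<mapsto> v)) = set (take (Suc i) \<sigma>)"
        "F s = y - probe_gain (\<sigma> ! i) (static_gain (drop (Suc i) \<sigma>)) (y - total s)"
        "act_cost ?C s () + measure_pmf.expectation (trans ?C s ()) F =
          y - (expect (\<sigma> ! i) (\<lambda>v. static_gain (drop (Suc i) \<sigma>) (y - total s - v)) - c (\<sigma> ! i))"
        using step[OF s False] by blast
      have "F s = y \<or> F s = act_cost ?C s () + measure_pmf.expectation (trans ?C s ()) F"
        unfolding i(5,6) by (auto simp: probe_gain_def max_def)
      moreover have "k - card (dom s') < k - card (dom s)" if "s' \<in> set_pmf (trans ?C s ())" for s'
        using that card[of i] card[of "Suc i"] i(1-4) by (auto simp del: dom_fun_upd)
      ultimately show ?thesis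
        using a by blast
    qed
  qed
  also have "\<dots> = y - static_gain \<sigma> y"
    by (simp add: F_def total_def chain_def additive_mdp_def)
  finally show ?thesis .
qed

subsection \<open>Increments of gains\<close>

lemma probe_gain_pos_iff: "0 < probe_gain j G z \<longleftrightarrow> c j < expect j (\<lambda>v. G (z - v))"
  by (simp add: probe_gain_def less_max_iff_disj)

lemma probe_gain_le:
  assumes j: "j < k" and G: "gain_function G"
  shows "expect j (\<lambda>v. G (z - v)) \<le> G z"
proof -
  have "expect j (\<lambda>v. G (z - v)) \<le> expect j (\<lambda>v. G z)"
    using component(2)[OF j] by (intro expect_mono[OF j] gain_function_mono[OF G]) simp
  then show ?thesis by simp
qed

text \<open>With budget equal to the index of the rest even a free probe leaves nothing to
  gain.\<close>

lemma gain_index_probe_mono: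
  assumes j: "j < k" and G: "gain_function G"
  shows "gain_index G \<le> gain_index (probe_gain j G)"
proof -
  have "G (gain_index G) = 0"
    using gain_zero_iff[OF G] by blast
  then have "probe_gain j G (gain_index G) = 0"
    using probe_gain_le[OF assms, of "gain_index G"] component(3)[OF j] by (simp add: probe_gain_def)
  then show ?thesis
    using gain_zero_iff[OF gain_function_probe[OF assms]] by blast
qed

text \<open>Strictly above the index the gain is positive, so the maximum is its second argument.
  The index itself is a limit case: raising the budget by \<open>e\<close> raises the expectation by
  at most \<open>e\<close>.\<close>

lemma probe_gain_active:
  assumes j: "j < k" and G: "gain_function G" and z: "gain_index (probe_gain j G) \<le> z"
  shows "probe_gain j G z = expect j (\<lambda>v. G (z - v)) - c j"
proof -
  have "c j \<le> expect j (\<lambda>v. G (z - v)) + e" if "0 < e" for e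
  proof -
    have "0 < probe_gain j G (z + e)"
      using gain_pos_iff[OF gain_function_probe[OF j G]] z that by simp
    then have "c j < expect j (\<lambda>v. G (z + e - v))"
      by (simp add: probe_gain_pos_iff)
    also have "\<dots> \<le> expect j (\<lambda>v. G (z - v) + e)"
    proof (rule expect_mono[OF j])
      show "G (z + e - v) \<le> G (z - v) + e" for v
        using gain_function_diff_le[OF G, of "z - v" "z + e - v"] that by simp
    qed
    also have "\<dots> = expect j (\<lambda>v. G (z - v)) + e"
      using j by (simp add: expect_add)
    finally show ?thesis by simp
  qed
  then have "c j \<le> expect j (\<lambda>v. G (z - v))"
    by (rule field_le_epsilon)
  then show ?thesis
    by (simp add: probe_gain_def)
qed

text \<open>\<open>G\<close> vanishes at \<open>?b\<close> and has slope at most 1, so with budget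
  \<open>?a + ?b\<close> it gains no more than \<open>j\<close> alone with budget \<open>?a\<close>,
  which does not pay for the probe.\<close>

lemma gain_index_probe_add:
  assumes j: "j < k" and G: "gain_function G"
  shows "gain_index (static_gain [j]) + gain_index G \<le> gain_index (probe_gain j G)"
proof (rule ccontr)
  let ?a = "gain_index (static_gain [j])" and ?b = "gain_index G"
  assume "\<not> ?thesis"
  then have "0 < probe_gain j G (?a + ?b)"
    using gain_pos_iff[OF gain_function_probe[OF assms]] by simp
  then have "c j < expect j (\<lambda>v. G (?a + ?b - v))"
    by (simp add: probe_gain_pos_iff)
  also have "\<dots> \<le> expect j (\<lambda>v. max 0 (?a - v))"
  proof (rule expect_mono[OF j])
    fix v
    have "G ?b = 0" using gain_zero_iff[OF G] by blast
    then show "G (?a + ?b - v) \<le> max 0 (?a - v)"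
      using gain_function_diff_le[OF G, of ?b "?a + ?b - v"]
        gain_function_mono[OF G, of "?a + ?b - v" ?b] by (cases "v \<le> ?a") auto
  qed
  finally have "0 < static_gain [j] ?a"
    by (simp add: probe_gain_pos_iff)
  moreover have "gain_function (static_gain [j])"
    using j by (intro gain_function_static) simp
  ultimately show False
    using gain_pos_iff by blast
qed

text \<open>With zero costs continuing never loses, so the recursion has no option to stop; it
  computes the expectation of \<open>max 0 (z - s)\<close> for \<open>s\<close> the sum of all
  values.\<close>

primrec free_gain :: "nat list \<Rightarrow> real \<Rightarrow> real" where
  "free_gain [] = (\<lambda>z. max 0 z)"
| "free_gain (j # \<sigma>) = (\<lambda>z. expect j (\<lambda>v. free_gain \<sigma> (z - v)))"

lemma free_gain_mono: "set \<sigma> \<subseteq> {..<k} \<Longrightarrow> w \<le> z \<Longrightarrow> free_gain \<sigma> w \<le> free_gain \<sigma> z"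
  by (induction \<sigma> arbitrary: w z) (auto intro!: expect_mono)

lemma free_gain_nonpos: "set \<sigma> \<subseteq> {..<k} \<Longrightarrow> z \<le> 0 \<Longrightarrow> free_gain \<sigma> z = 0"
proof (induction \<sigma> arbitrary: z)
  case (Cons j \<sigma>)
  have "expect j (\<lambda>v. free_gain \<sigma> (z - v)) = expect j (\<lambda>v. 0)"
  proof (rule expect_cong)
    fix v assume "v \<in> set_pmf (D j)"
    then have "z - v \<le> 0"
      using component(2)[of j v] Cons.prems by simp
    then show "free_gain \<sigma> (z - v) = 0"
      using Cons by simp
  qed
  then show ?case by simp
qed simp

text \<open>By independence the free gain is symmetric, so whichever component an adaptive policy
  probes first can be brought to the front.\<close>

lemma free_gain_move_front:
  "j < k \<Longrightarrow> set \<sigma> \<subseteq> {..<k} \<Longrightarrow> free_gain (\<sigma> @ j # \<tau>) z = free_gain (j # \<sigma> @ \<tau>) z"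
proof (induction \<sigma> arbitrary: z)
  case (Cons i \<sigma>)
  have "free_gain ((i # \<sigma>) @ j # \<tau>) z = expect i (\<lambda>u. expect j (\<lambda>v. free_gain (\<sigma> @ \<tau>) (z - u - v)))"
    using Cons by simp
  also have "\<dots> = expect j (\<lambda>v. expect i (\<lambda>u. free_gain (\<sigma> @ \<tau>) (z - u - v)))"
    using Cons.prems by (intro expect_swap) auto
  also have "\<dots> = expect j (\<lambda>v. expect i (\<lambda>u. free_gain (\<sigma> @ \<tau>) (z - v - u)))"
    by (intro expect_cong arg_cong[where f = "free_gain _"]) simp
  also have "\<dots> = free_gain (j # (i # \<sigma>) @ \<tau>) z"
    by simp
  finally show ?case .
qed simp

lemma opt_gain_ge_probe:
  "finite T \<Longrightarrow> j \<in> T \<Longrightarrow> probe_gain j (opt_gain n (T - {j})) z \<le> opt_gain (Suc n) T z"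
  by simp

lemma opt_gain_attained:
  assumes "finite T" "T \<noteq> {}"
  obtains j where "j \<in> T" "opt_gain (Suc n) T z = probe_gain j (opt_gain n (T - {j})) z"
proof -
  have "opt_gain (Suc n) T z \<in> (\<lambda>j. probe_gain j (opt_gain n (T - {j})) z) ` T"
    unfolding opt_gain.simps using assms by (intro Max_in) auto
  then show ?thesis using that by blast
qed

text \<open>Let \<open>j\<close> be an optimal first probe at \<open>z\<close>. Using
  \<open>j\<close> at \<open>w\<close> too can only lower the gain there; the cost of
  \<open>j\<close> then cancels, and the induction hypothesis applies after the probe.\<close>

lemma opt_gain_increment:
  assumes "distinct \<sigma>" "set \<sigma> \<subseteq> {..<k}" "length \<sigma> = n" "w \<le> z"
  shows "opt_gain n (set \<sigma>) z - opt_gain n (set \<sigma>) w \<le> free_gain \<sigma> z - free_gain \<sigma> w"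
  using assms
proof (induction n arbitrary: \<sigma> w z)
  case (Suc n)
  let ?T = "set \<sigma>"
  have "?T \<noteq> {}" using Suc.prems by auto
  then obtain j where j: "j \<in> ?T" "opt_gain (Suc n) ?T z = probe_gain j (opt_gain n (?T - {j})) z"
    by (rule opt_gain_attained[OF finite_set])
  obtain \<sigma>1 \<sigma>2 where split: "\<sigma> = \<sigma>1 @ j # \<sigma>2"
    using j(1) by (meson split_list)
  let ?\<tau> = "\<sigma>1 @ \<sigma>2" and ?R = "?T - {j}"
  have R: "?R = set ?\<tau>" and \<tau>: "distinct ?\<tau>" "set ?\<tau> \<subseteq> {..<k}" "length ?\<tau> = n" and jk: "j < k"
    using Suc.prems split by auto
  have free: "free_gain \<sigma> x = expect j (\<lambda>v. free_gain ?\<tau> (x - v))" for x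
    unfolding split using \<tau>(2) jk by (subst free_gain_move_front) auto
  have "expect j (\<lambda>v. opt_gain n ?R (z - v)) - expect j (\<lambda>v. opt_gain n ?R (w - v))
      = expect j (\<lambda>v. opt_gain n ?R (z - v) - opt_gain n ?R (w - v))"
    using jk by (simp add: expect_diff)
  also have "\<dots> \<le> expect j (\<lambda>v. free_gain ?\<tau> (z - v) - free_gain ?\<tau> (w - v))"
  proof (rule expect_mono[OF jk])
    show "opt_gain n ?R (z - v) - opt_gain n ?R (w - v) \<le> free_gain ?\<tau> (z - v) - free_gain ?\<tau> (w - v)" for v
      unfolding R using Suc.prems(4) by (intro Suc.IH \<tau>) simp
  qed
  also have "\<dots> = free_gain \<sigma> z - free_gain \<sigma> w"
    using jk by (simp add: expect_diff free)
  finally have le: "expect j (\<lambda>v. opt_gain n ?R (z - v)) - expect j (\<lambda>v. opt_gain n ?R (w - v))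
      \<le> free_gain \<sigma> z - free_gain \<sigma> w" .
  have "max 0 (a - e) - max 0 (b - e) \<le> x" if "a - b \<le> x" "0 \<le> x" for a b e x :: real
    using that by (simp add: max_def)
  from this[OF le]
  have "probe_gain j (opt_gain n ?R) z - probe_gain j (opt_gain n ?R) w \<le> free_gain \<sigma> z - free_gain \<sigma> w"
    using free_gain_mono[OF Suc.prems(2,4)] by (simp add: probe_gain_def)
  then show ?case
    using opt_gain_ge_probe[OF finite_set j(1), of n w] j(2) by linarith
qed auto

text \<open>With budget at least \<open>w + B\<close> it is optimal to probe \<open>j\<close>, so the cost of \<open>j\<close> cancels in the increment.\<close>

lemma static_gain_increment_Cons:
  assumes jk: "j < k" and \<sigma>: "set \<sigma> \<subseteq> {..<k}"
    and IH: "\<And>w z. w \<le> z \<Longrightarrow>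
      free_gain \<sigma> z - free_gain \<sigma> w \<le> static_gain \<sigma> (z + B) - static_gain \<sigma> (w + B)"
    and idx: "gain_index (static_gain (j # \<sigma>)) \<le> w + B" and "w \<le> z"
  shows "free_gain (j # \<sigma>) z - free_gain (j # \<sigma>) w
    \<le> static_gain (j # \<sigma>) (z + B) - static_gain (j # \<sigma>) (w + B)"
proof -
  have active: "static_gain (j # \<sigma>) (x + B) = expect j (\<lambda>v. static_gain \<sigma> (x + B - v)) - c j" if "w \<le> x" for x
    using probe_gain_active[OF jk gain_function_static[OF \<sigma>], of "x + B"] idx that by simp
  have "free_gain (j # \<sigma>) z - free_gain (j # \<sigma>) w
      = expect j (\<lambda>v. free_gain \<sigma> (z - v) - free_gain \<sigma> (w - v))"
    using jk by (simp add: expect_diff)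
  also have "\<dots> \<le> expect j (\<lambda>v. static_gain \<sigma> (z + B - v) - static_gain \<sigma> (w + B - v))"
  proof (rule expect_mono[OF jk])
    show "free_gain \<sigma> (z - v) - free_gain \<sigma> (w - v) \<le> static_gain \<sigma> (z + B - v) - static_gain \<sigma> (w + B - v)" for v
      using IH[of "w - v" "z - v"] \<open>w \<le> z\<close> by (simp add: algebra_simps)
  qed
  also have "\<dots> = static_gain (j # \<sigma>) (z + B) - static_gain (j # \<sigma>) (w + B)"
    unfolding active[OF \<open>w \<le> z\<close>] active[OF order_refl] using jk by (simp add: expect_diff)
  finally show ?thesis .
qed

text \<open>Suffixes also have index at most \<open>B\<close>, so for \<open>w \<ge> 0\<close> the
  budget \<open>w + B\<close> makes the first probe worthwhile and the induction hypothesis covers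
  the rest.\<close>

lemma static_gain_increment:
  assumes "set \<sigma> \<subseteq> {..<k}" "gain_index (static_gain \<sigma>) \<le> B" "w \<le> z"
  shows "free_gain \<sigma> z - free_gain \<sigma> w \<le> static_gain \<sigma> (z + B) - static_gain \<sigma> (w + B)"
  using assms
proof (induction \<sigma> arbitrary: w z)
  case Nil
  have "0 \<le> B"
    using gain_index_nonneg[OF gain_function_max_zero] Nil.prems(2) by simp
  then show ?case
    using Nil.prems(3) by (simp add: max_def)
next
  case (Cons j \<sigma>)
  have jk: "j < k" and \<sigma>: "set \<sigma> \<subseteq> {..<k}"
    using Cons.prems by auto
  note G = gain_function_static[OF Cons.prems(1)]
  have "gain_index (static_gain \<sigma>) \<le> B"
    using gain_index_probe_mono[OF jk gain_function_static[OF \<sigma>]] Cons.prems(2) by simp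
  note IH = Cons.IH[OF \<sigma> this]
  have pos: "free_gain (j # \<sigma>) z - free_gain (j # \<sigma>) w
      \<le> static_gain (j # \<sigma>) (z + B) - static_gain (j # \<sigma>) (w + B)" if "0 \<le> w" "w \<le> z" for w z
    using Cons.prems(2) that by (intro static_gain_increment_Cons[OF jk \<sigma> IH]) auto
  show ?case
  proof (cases "0 \<le> w")
    case False
    \<comment> \<open>The free gain vanishes up to budget 0, so only the part from 0 on has to be
      compared; the static gain is monotone on the part below.\<close>
    then have w0: "free_gain (j # \<sigma>) w = 0" "free_gain (j # \<sigma>) 0 = 0"
      using free_gain_nonpos[OF Cons.prems(1), of w] free_gain_nonpos[OF Cons.prems(1), of 0] by auto
    have mono: "static_gain (j # \<sigma>) (w + B) \<le> static_gain (j # \<sigma>) (0 + B)"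
      "static_gain (j # \<sigma>) (w + B) \<le> static_gain (j # \<sigma>) (z + B)"
      using False Cons.prems(3) by (intro gain_function_mono[OF G]; simp)+
    show ?thesis
    proof (cases "0 \<le> z")
      case True
      then show ?thesis
        using pos[of 0 z] w0 mono by linarith
    next
      case False
      then have "free_gain (j # \<sigma>) z = 0"
        using free_gain_nonpos[OF Cons.prems(1)] by simp
      then show ?thesis
        using w0 mono by linarith
    qed
  qed (use pos Cons.prems(3) in blast)
qed

text \<open>The increments from 0 to \<open>w\<close> are compared through the free gain, and the
  adaptive gain vanishes at 0.\<close>

lemma opt_gain_le_static_shift:
  assumes "distinct \<sigma>" "set \<sigma> = T" "T \<subseteq> {..<k}" "card T = n" "gain_index (static_gain \<sigma>) \<le> B"
  shows "opt_gain n T w \<le> static_gain \<sigma> (w + B)"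
proof -
  have \<sigma>: "set \<sigma> \<subseteq> {..<k}" "length \<sigma> = n"
    using assms distinct_card[of \<sigma>] by auto
  note opt = gain_function_opt[OF assms(3,4)]
  note G = gain_function_static[OF \<sigma>(1)]
  show ?thesis
  proof (cases "0 \<le> w")
    case True
    have "opt_gain n T w - opt_gain n T 0 \<le> static_gain \<sigma> (w + B) - static_gain \<sigma> (0 + B)"
      using opt_gain_increment[OF assms(1) \<sigma> True] static_gain_increment[OF \<sigma>(1) assms(5) True] assms(2)
      by simp
    then show ?thesis
      using gain_function_nonpos[OF opt, of 0] gain_function_nonneg[OF G, of "0 + B"] by linarith
  next
    case False
    then show ?thesis
      using gain_function_nonpos[OF opt, of w] gain_function_nonneg[OF G, of "w + B"] by linarith
  qed
qed

subsection \<open>Indices of static orders\<close>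

text \<open>The last assumption says that \<open>z\<close> exceeds the adaptive index; its
  strictness provides slack for the induction. Two further components in front raise the bound by
  only one \<open>z\<close>, whence the factor \<open>(n + 1) div 2\<close>.\<close>

lemma static_index_le:
  assumes "T \<subseteq> {..<k}" "card T = n" "0 < opt_gain n T z"
  shows "\<exists>\<sigma>. distinct \<sigma> \<and> set \<sigma> = T \<and> gain_index (static_gain \<sigma>) \<le> real ((n + 1) div 2) * z"
  using assms
proof (induction n arbitrary: T z rule: induct_nat_012)
  case 0
  have "T = {}"
    using finite_subset[OF 0(1)] 0(2) by simp
  moreover have "gain_index (static_gain []) \<le> 0"
    using gain_index_le_iff[OF gain_function_max_zero] by simp
  ultimately show ?case
    by (intro exI[of _ "[]"]) simp
next
  case 1
  then obtain j where T: "T = {j}"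
    by (metis One_nat_def card_1_singletonE)
  then have "0 < static_gain [j] z"
    using 1 by simp
  moreover have "gain_function (static_gain [j])"
    using 1 T by (intro gain_function_static) simp
  ultimately have "gain_index (static_gain [j]) < z"
    using gain_pos_iff by blast
  then show ?case
    using T by (intro exI[of _ "[j]"]) simp
next
  case (ge2 n)
  have finT: "finite T" using finite_subset[OF ge2(3)] by simp
  have "T \<noteq> {}" using ge2(4) by auto
  then obtain i where i: "i \<in> T" "opt_gain (Suc (Suc n)) T z = probe_gain i (opt_gain (Suc n) (T - {i})) z"
    by (rule opt_gain_attained[OF finT])
  define T' where "T' = T - {i}"
  let ?a = "opt_gain (Suc n) T'"
  have T': "T' \<subseteq> {..<k}" "card T' = Suc n" "finite T'" and ik: "i < k"
    using ge2(3,4) i(1) finT by (auto simp: T'_def)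
  have "T' \<noteq> {}" using T'(2) by auto
  note a = gain_function_opt[OF T'(1,2)]
  \<comment> \<open>The slack of probing \<open>i\<close> with budget \<open>z\<close>; half of it
    pays for replacing the adaptive gain of the rest by a static one.\<close>
  define \<delta> where "\<delta> = expect i (\<lambda>v. ?a (z - v)) - c i"
  have \<delta>: "0 < \<delta>"
    using ge2(5) i(2) by (simp add: \<delta>_def T'_def probe_gain_pos_iff del: opt_gain.simps)
  have az: "\<delta> \<le> ?a z"
    using probe_gain_le[OF ik a, of z] component(3)[OF ik] by (simp add: \<delta>_def)
  have z: "0 < z"
    using az \<delta> gain_function_nonpos[OF a, of z] by (cases "z \<le> 0") auto
  \<comment> \<open>A point just above the index of \<open>T'\<close>: positive gain, but too small to use up the slack \<open>\<delta>\<close>.\<close>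
  have "\<exists>u. 0 \<le> u \<and> u \<le> z \<and> ?a u = \<delta> / 2"
    using az \<delta> z gain_function_nonpos[OF a, of 0] gain_function_continuous[OF a]
    by (intro IVT') auto
  then obtain u where u: "0 \<le> u" "u \<le> z" "?a u = \<delta> / 2" by blast
  obtain j where j: "j \<in> T'" "?a u = probe_gain j (opt_gain n (T' - {j})) u"
    by (rule opt_gain_attained[OF T'(3) \<open>T' \<noteq> {}\<close>])
  define T'' where "T'' = T' - {j}"
  let ?b = "opt_gain n T''"
  have T'': "T'' \<subseteq> {..<k}" "card T'' = n" and jk: "j < k"
    using T' j by (auto simp: T''_def)
  note b = gain_function_opt[OF T'']
  have bu: "c j < expect j (\<lambda>v. ?b (u - v))"
    using u(3) j(2) \<delta> by (simp add: T''_def flip: probe_gain_pos_iff)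
  \<comment> \<open>So \<open>z\<close> exceeds the adaptive index of \<open>T''\<close> too, and
    the induction hypothesis applies with the same \<open>z\<close>.\<close>
  have "0 < ?b z"
    using probe_gain_le[OF jk b, of u] bu component(3)[OF jk] gain_function_mono[OF b u(2)] by linarith
  then obtain \<sigma> where \<sigma>: "distinct \<sigma>" "set \<sigma> = T''" "gain_index (static_gain \<sigma>) \<le> real ((n + 1) div 2) * z"
    using ge2(1)[OF T''] by blast
  define B where "B = real ((n + 1) div 2) * z"
  note \<sigma>_idx = \<sigma>(3)[folded B_def]
  have \<sigma>k: "set \<sigma> \<subseteq> {..<k}" using \<sigma>(2) T''(1) by simp
  let ?\<rho> = "j # \<sigma>"
  have \<rho>: "distinct ?\<rho>" "set ?\<rho> = T'" "set ?\<rho> \<subseteq> {..<k}"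
    using \<sigma> j T'(1) by (auto simp: T''_def)
  then have \<rho>_len: "length ?\<rho> = Suc n"
    using T'(2) distinct_card by metis
  note G = gain_function_static[OF \<rho>(3)]
  \<comment> \<open>After the probe of \<open>j\<close>, the order \<open>\<sigma>\<close> with
    \<open>B\<close> added to the budget does as well as the adaptive policy, so probing
    \<open>j\<close> pays off at \<open>u + B\<close>.\<close>
  have "expect j (\<lambda>v. ?b (u - v)) \<le> expect j (\<lambda>v. static_gain \<sigma> (u + B - v))"
  proof (rule expect_mono[OF jk])
    show "?b (u - v) \<le> static_gain \<sigma> (u + B - v)" for v
      using opt_gain_le_static_shift[OF \<sigma>(1,2) T'' \<sigma>_idx, of "u - v"] by (simp add: algebra_simps)
  qed
  with bu have "0 < static_gain ?\<rho> (u + B)"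
    by (simp add: probe_gain_pos_iff)
  then have \<rho>_idx: "gain_index (static_gain ?\<rho>) \<le> u + B"
    using gain_pos_iff[OF G] by (simp add: less_imp_le)
  \<comment> \<open>From \<open>u\<close> on, increments are compared through the free gain; below
    \<open>u\<close> the adaptive gain is at most \<open>\<delta> / 2\<close>. The index of
    \<open>?\<rho>\<close> is bounded by \<open>u + B\<close>, not by \<open>B\<close>, so the
    one-step increment lemma is applied from \<open>u\<close> on.\<close>
  have shift: "?a w - \<delta> / 2 \<le> static_gain ?\<rho> (w + B)" for w
  proof (cases "u \<le> w")
    case True
    have "free_gain ?\<rho> w - free_gain ?\<rho> u \<le> static_gain ?\<rho> (w + B) - static_gain ?\<rho> (u + B)"
      using \<rho>_idx True by (intro static_gain_increment_Cons[OF jk \<sigma>k static_gain_increment[OF \<sigma>k \<sigma>_idx]])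
    moreover have "?a w - ?a u \<le> free_gain ?\<rho> w - free_gain ?\<rho> u"
      using opt_gain_increment[OF \<rho>(1,3) \<rho>_len True] unfolding \<rho>(2) .
    ultimately show ?thesis
      using u(3) gain_function_nonneg[OF G, of "u + B"] by linarith
  next
    case False
    then have "?a w \<le> ?a u"
      by (intro gain_function_mono[OF a]) simp
    then show ?thesis
      using u(3) gain_function_nonneg[OF G, of "w + B"] by linarith
  qed
  have "c i < expect i (\<lambda>v. ?a (z - v)) - \<delta> / 2"
    using \<delta> by (simp add: \<delta>_def field_simps)
  also have "\<dots> = expect i (\<lambda>v. ?a (z - v) - \<delta> / 2)"
    using ik by (simp add: expect_diff del: opt_gain.simps)
  also have "\<dots> \<le> expect i (\<lambda>v. static_gain ?\<rho> (z + B - v))"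
  proof (rule expect_mono[OF ik])
    show "?a (z - v) - \<delta> / 2 \<le> static_gain ?\<rho> (z + B - v)" for v
      using shift[of "z - v"] by (simp only: add_diff_eq diff_add_eq)
  qed
  finally have "0 < static_gain (i # ?\<rho>) (z + B)"
    by (simp add: probe_gain_pos_iff)
  moreover have order: "distinct (i # ?\<rho>)" "set (i # ?\<rho>) = T"
    using \<rho> i(1) by (auto simp: T'_def)
  moreover have "gain_function (static_gain (i # ?\<rho>))"
    using order(2) ge2(3) by (intro gain_function_static) simp
  ultimately have "gain_index (static_gain (i # ?\<rho>)) \<le> z + B"
    using gain_pos_iff less_imp_le by blast
  also have "z + B = real ((Suc (Suc n) + 1) div 2) * z"
    by (simp add: B_def algebra_simps)
  finally show ?case
    using order by blast
qed

subsection \<open>Pointwise approximation\<close>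

lemma index_static:
  "static_order \<sigma> \<pi> \<Longrightarrow> index (additive_mdp k D c) \<pi> = gain_index (static_gain \<sigma>)"
  using Greatest_gain_zero[OF gain_function_static[of \<sigma>]]
  by (simp add: index_def local_cost_static static_order_def)

text \<open>Distribution functions are right derivatives of gains, so short increments at
  \<open>y\<close> and at \<open>\<alpha> * y\<close> decide the matter. Below its index the
  adaptive gain is flat, and monotonicity of the static gain suffices.\<close>

lemma pointwise_approxI:
  assumes comm: "static_commitment k D c \<pi>" and order: "static_order \<sigma> \<pi>" and "0 < \<alpha>"
    and incr: "\<And>y. gain_index (opt_gain k {..<k}) \<le> y \<Longrightarrow> \<exists>\<delta>>0. \<forall>h. 0 < h \<longrightarrow> h < \<delta> \<longrightarrow>
      opt_gain k {..<k} (y + h) - opt_gain k {..<k} y \<le> static_gain \<sigma> (\<alpha> * y + h) - static_gain \<sigma> (\<alpha> * y)"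
  shows "pointwise_approx (additive_mdp k D c) \<pi> \<alpha>"
proof -
  let ?M = "additive_mdp k D c" and ?G = "opt_gain k {..<k}" and ?H = "static_gain \<sigma>"
  have G: "gain_function ?G"
    by (intro gain_function_opt) auto
  have H: "gain_function ?H"
    using order by (intro gain_function_static) (simp add: static_order_def)
  have sG: "is_surrogate_cost ?M (surrogate_cost ?M)"
    by (rule surrogate_cost[OF local_cost_additive G])
  have sH: "is_surrogate_cost (chain ?M \<pi>) (surrogate_cost (chain ?M \<pi>))"
    by (rule surrogate_cost[OF local_cost_static[OF order] H])
  have "cdf (surrogate_cost ?M) y \<le> cdf (surrogate_cost (chain ?M \<pi>)) (\<alpha> * y)" for y
  proof -
    have "\<exists>\<delta>>0. \<forall>h. 0 < h \<longrightarrow> h < \<delta> \<longrightarrow> ?G (y + h) - ?G y \<le> ?H (\<alpha> * y + h) - ?H (\<alpha> * y)"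
    proof (cases "gain_index ?G \<le> y")
      case False
      have "?G (y + h) - ?G y \<le> ?H (\<alpha> * y + h) - ?H (\<alpha> * y)" if "0 < h" "h < gain_index ?G - y" for h
      proof -
        have "?G (y + h) = 0"
          using gain_zero_iff[OF G] that by simp
        then show ?thesis
          using gain_function_nonneg[OF G, of y] gain_function_mono[OF H, of "\<alpha> * y" "\<alpha> * y + h"] that
          by linarith
      qed
      then show ?thesis
        using False by (intro exI[of _ "gain_index ?G - y"]) auto
    qed (rule incr)
    then show ?thesis
      using surrogate_cdf_le[OF local_cost_additive sG local_cost_static[OF order] sH] by blast
  qed
  then show ?thesis
    unfolding pointwise_approx_def using quantile_scale_le[OF \<open>0 < \<alpha>\<close>] comm
    by (auto simp: static_commitment_def)
qed

text \<open>The shift \<open>(\<alpha> - 1) * y\<close> takes \<open>y\<close> to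
  \<open>\<alpha> * y\<close>. It has to dominate the index of the suffix \<open>\<sigma>\<close>
  only; for the full order index at most \<open>\<alpha> * y\<close> is enough.\<close>

lemma increment_le_static_scaled:
  assumes \<sigma>: "distinct (j # \<sigma>)" "set (j # \<sigma>) = {..<k}"
    and idx: "gain_index (static_gain (j # \<sigma>)) \<le> \<alpha> * y" "gain_index (static_gain \<sigma>) \<le> (\<alpha> - 1) * y"
    and "0 < h"
  shows "opt_gain k {..<k} (y + h) - opt_gain k {..<k} y
    \<le> static_gain (j # \<sigma>) (\<alpha> * y + h) - static_gain (j # \<sigma>) (\<alpha> * y)"
proof -
  let ?B = "(\<alpha> - 1) * y"
  have jk: "j < k" and \<sigma>k: "set \<sigma> \<subseteq> {..<k}" using \<sigma>(2) by auto
  have B: "y + ?B = \<alpha> * y" "y + h + ?B = \<alpha> * y + h" by (simp_all add: algebra_simps)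
  have len: "length (j # \<sigma>) = k" using distinct_card[OF \<sigma>(1)] \<sigma>(2) by simp
  have "opt_gain k {..<k} (y + h) - opt_gain k {..<k} y \<le> free_gain (j # \<sigma>) (y + h) - free_gain (j # \<sigma>) y"
    using opt_gain_increment[OF \<sigma>(1) _ len, of y "y + h"] \<open>0 < h\<close> unfolding \<sigma>(2) by simp
  also have "\<dots> \<le> static_gain (j # \<sigma>) (y + h + ?B) - static_gain (j # \<sigma>) (y + ?B)"
    using idx(1) \<open>0 < h\<close> by (intro static_gain_increment_Cons[OF jk \<sigma>k static_gain_increment[OF \<sigma>k idx(2)]]) (auto simp: B)
  finally show ?thesis unfolding B .
qed

text \<open>For \<open>y\<close> at least the adaptive index, the minimum static index is at most
  \<open>?m * y\<close>, hence so is that of the suffix. The shift by \<open>?m * y\<close> on top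
  of \<open>y\<close> gives the factor \<open>1 + ?m\<close>.\<close>

lemma min_index_static_approx:
  assumes "min_index_static k D c \<pi>"
  shows "pointwise_approx (additive_mdp k D c) \<pi> (1 + real ((k + 1) div 2))"
proof -
  let ?G = "opt_gain k {..<k}" and ?m = "real ((k + 1) div 2)"
  have k: "1 \<le> k" using box by (simp add: additive_box_def)
  have G: "gain_function ?G" by (intro gain_function_opt) auto
  obtain \<rho> where comm: "static_commitment k D c \<pi>" and order: "static_order \<rho> \<pi>"
    using assms by (auto simp: min_index_static_def static_commitment_iff)
  have "0 \<in> set \<rho>" using order k by (simp add: static_order_def)
  then obtain j \<sigma> where \<rho>: "\<rho> = j # \<sigma>"
    by (cases \<rho>) auto
  have \<sigma>: "distinct (j # \<sigma>)" "set (j # \<sigma>) = {..<k}"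
    using order by (auto simp: static_order_def \<rho>)
  have jk: "j < k" and \<sigma>k: "set \<sigma> \<subseteq> {..<k}" using \<sigma>(2) by auto
  have m: "0 < ?m" using k by simp
  have idx: "gain_index (static_gain \<rho>) \<le> ?m * z" if z: "gain_index ?G < z" for z
  proof -
    obtain \<tau> where \<tau>: "distinct \<tau>" "set \<tau> = {..<k}" "gain_index (static_gain \<tau>) \<le> ?m * z"
      using static_index_le[of "{..<k}" k z] gain_pos_iff[OF G] z by auto
    obtain \<pi>' where \<pi>': "static_commitment k D c \<pi>'" "static_order \<tau> \<pi>'"
      using static_commitment_exists[OF \<tau>(1,2)] .
    have "gain_index (static_gain \<rho>) \<le> gain_index (static_gain \<tau>)"
      using assms \<pi>' index_static[OF order] index_static[OF \<pi>'(2)] by (auto simp: min_index_static_def)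
    with \<tau>(3) show ?thesis by simp
  qed
  have idx_le: "gain_index (static_gain \<rho>) \<le> ?m * y" if "gain_index ?G \<le> y" for y
  proof -
    \<comment> \<open>The bound is known strictly above the adaptive index; letting \<open>z\<close>
      decrease to \<open>y\<close> includes the index itself.\<close>
    have "gain_index (static_gain \<rho>) / ?m \<le> z" if "y < z" for z
      using idx[of z] \<open>gain_index ?G \<le> y\<close> that m by (simp add: field_simps)
    then have "gain_index (static_gain \<rho>) / ?m \<le> y"
      by (rule dense_ge)
    then show ?thesis using m by (simp add: field_simps)
  qed
  show ?thesis
  proof (rule pointwise_approxI[OF comm order])
    fix y assume y: "gain_index ?G \<le> y"
    then have "0 \<le> y" using gain_index_nonneg[OF G] by simp
    have "gain_index (static_gain (j # \<sigma>)) \<le> (1 + ?m) * y"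
      using idx_le[OF y] \<open>0 \<le> y\<close> by (simp add: \<rho> distrib_right)
    moreover have "gain_index (static_gain \<sigma>) \<le> (1 + ?m - 1) * y"
      using idx_le[OF y] gain_index_probe_mono[OF jk gain_function_static[OF \<sigma>k]] by (simp add: \<rho>)
    ultimately show "\<exists>\<delta>>0. \<forall>h. 0 < h \<longrightarrow> h < \<delta> \<longrightarrow>
        ?G (y + h) - ?G y \<le> static_gain \<rho> ((1 + ?m) * y + h) - static_gain \<rho> ((1 + ?m) * y)"
      unfolding \<rho> using increment_le_static_scaled[OF \<sigma>] by (intro exI[of _ 1]) auto
  qed simp
qed

subsection \<open>Two components\<close>

text \<open>After the first probe the other component is forced, so adaptivity only means choosing
  the order according to the budget.\<close>

lemma opt_gain_two:
  assumes "i \<noteq> j"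
  shows "opt_gain 2 {i, j} z = max (static_gain [i, j] z) (static_gain [j, i] z)"
proof -
  have "{i, j} - {i} = {j}" "{i, j} - {j} = {i}" using assms by auto
  then show ?thesis
    by (simp add: numeral_2_eq_2)
qed

text \<open>Which order works depends on the index \<open>?b\<close> of \<open>j\<close> alone. If
  \<open>?b\<close> is large relative to \<open>?h\<close>, then \<open>?h\<close> is not far above
  \<open>?f\<close> and superadditivity of indices makes \<open>?a\<close> small, which favours the
  order ending in \<open>i\<close>.\<close>

lemma two_components_approx:
  fixes \<phi> :: real
  defines "\<phi> \<equiv> (1 + sqrt 5) / 2"
  assumes ij: "i \<noteq> j" "{..<k} = {i, j}"
    and le: "gain_index (static_gain [i, j]) \<le> gain_index (static_gain [j, i])"
  shows "\<exists>\<pi>. static_commitment k D c \<pi> \<and> pointwise_approx (additive_mdp k D c) \<pi> \<phi>"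
proof -
  have k: "k = 2"
    using ij card_lessThan[of k] by simp
  have ik: "i < k" "j < k" using ij(2) by auto
  let ?G = "opt_gain k {..<k}" and ?F = "static_gain [i, j]" and ?H = "static_gain [j, i]"
  let ?f = "gain_index ?F" and ?h = "gain_index ?H"
    and ?a = "gain_index (static_gain [i])" and ?b = "gain_index (static_gain [j])"
  have gain: "gain_function ?G" "gain_function ?F" "gain_function ?H" "gain_function (static_gain [j])"
    using ik by (auto intro!: gain_function_opt gain_function_static simp del: static_gain.simps)
  have G: "?G z = max (?F z) (?H z)" for z
    unfolding ij(2) unfolding k using opt_gain_two[OF ij(1)] .
  have sqrt5: "2 \<le> sqrt 5" by (rule real_le_rsqrt) simp
  have \<phi>: "3 / 2 \<le> \<phi>" "\<phi> * (\<phi> - 1) = 1"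
    using sqrt5 by (auto simp: \<phi>_def field_simps)
  have f_le: "?f \<le> gain_index ?G"
  proof -
    have "?G ?f = 0"
      unfolding G using gain_zero_iff[OF gain(2), of ?f] gain_zero_iff[OF gain(3), of ?f] le by simp
    then show ?thesis
      using gain_zero_iff[OF gain(1)] by blast
  qed
  have f0: "0 \<le> ?f" by (rule gain_index_nonneg[OF gain(2)])
  have b_le: "?b \<le> ?f"
    using gain_index_probe_mono[OF ik(1) gain(4)] by simp
  have ab_le: "?a + ?b \<le> ?f"
    using gain_index_probe_add[OF ik(1) gain(4)] by simp
  have orders: "distinct [i, j]" "set [i, j] = {..<k}" "distinct [j, i]" "set [j, i] = {..<k}"
    using ij by auto
  show ?thesis
  proof (cases "?b \<le> (\<phi> - 1) * ?h")
    \<comment> \<open>Below \<open>?h\<close> the order \<open>[i, j]\<close> is optimal, so \<open>?b\<close> needs to be small relative to \<open>?h\<close> only.\<close>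
    case True
    obtain \<pi> where \<pi>: "static_commitment k D c \<pi>" "static_order [i, j] \<pi>"
      using static_commitment_exists[OF orders(1,2)] .
    have "pointwise_approx (additive_mdp k D c) \<pi> \<phi>"
    proof (rule pointwise_approxI[OF \<pi>])
      fix y assume "gain_index ?G \<le> y"
      then have y: "?f \<le> y" "0 \<le> y" using f_le f0 by auto
      have y\<phi>: "y \<le> \<phi> * y" using y(2) \<phi>(1) mult_right_mono[of 1 \<phi> y] by simp
      show "\<exists>\<delta>>0. \<forall>h. 0 < h \<longrightarrow> h < \<delta> \<longrightarrow> ?G (y + h) - ?G y \<le> ?F (\<phi> * y + h) - ?F (\<phi> * y)"
      proof (cases "?h \<le> y")
        case h: True
        have "?b \<le> (\<phi> - 1) * y"
          using True mult_left_mono[OF h, of "\<phi> - 1"] \<phi>(1) by linarith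
        moreover have "?f \<le> \<phi> * y" using y y\<phi> by linarith
        ultimately show ?thesis
          using increment_le_static_scaled[OF orders(1,2)] by (intro exI[of _ 1]) auto
      next
        case h: False
        \<comment> \<open>\<open>?H\<close> vanishes up to \<open>?h\<close>, so there
          \<open>?G\<close> is the convex function \<open>?F\<close>, whose increments at
          \<open>\<phi> * y\<close> are at least those at \<open>y\<close>.\<close>
        have "?G x = ?F x" if "x \<le> ?h" for x
          unfolding G using gain_zero_iff[OF gain(3), of x] that gain_function_nonneg[OF gain(2), of x] by simp
        then show ?thesis
          using h gain_function_increment_mono[OF gain(2) y\<phi>] by (intro exI[of _ "?h - y"]) auto
      qed
    qed (use \<phi> in simp)
    with \<pi>(1) show ?thesis by blast
  next
    case False
    obtain \<pi> where \<pi>: "static_commitment k D c \<pi>" "static_order [j, i] \<pi>"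
      using static_commitment_exists[OF orders(3,4)] .
    \<comment> \<open>The equation \<open>\<phi> * (\<phi> - 1) = 1\<close> balances the two cases:
      failure of the first yields exactly the bound on \<open>?h\<close> for the second.\<close>
    have "\<phi> * ((\<phi> - 1) * ?h) \<le> \<phi> * ?b"
      using False \<phi>(1) by (intro mult_left_mono) auto
    then have h_le: "?h \<le> \<phi> * ?b"
      using \<phi>(2) by (simp add: mult.assoc[symmetric])
    \<comment> \<open>As \<open>?b\<close> exceeds \<open>(\<phi> - 1) * ?f\<close>, superadditivity
      leaves at most \<open>(2 - \<phi>) * ?f\<close> for \<open>?a\<close>, and
      \<open>3 / 2 \<le> \<phi>\<close> does the rest.\<close>
    have "(\<phi> - 1) * ?f \<le> (\<phi> - 1) * ?h"
      using le \<phi>(1) by (intro mult_left_mono) auto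
    then have "?a \<le> (2 - \<phi>) * ?f"
      using False ab_le by (simp add: algebra_simps)
    also have "\<dots> \<le> (\<phi> - 1) * ?f"
      using \<phi>(1) f0 by (intro mult_right_mono) auto
    finally have a_le: "?a \<le> (\<phi> - 1) * ?f" .
    have "pointwise_approx (additive_mdp k D c) \<pi> \<phi>"
    proof (rule pointwise_approxI[OF \<pi>])
      fix y assume "gain_index ?G \<le> y"
      then have y: "?f \<le> y" using f_le by simp
      have "\<phi> * ?b \<le> \<phi> * y" "(\<phi> - 1) * ?f \<le> (\<phi> - 1) * y"
        using b_le y \<phi>(1) by (auto intro!: mult_left_mono)
      with h_le a_le have "?h \<le> \<phi> * y" "?a \<le> (\<phi> - 1) * y" by linarith+
      then show "\<exists>\<delta>>0. \<forall>h. 0 < h \<longrightarrow> h < \<delta> \<longrightarrow> ?G (y + h) - ?G y \<le> ?H (\<phi> * y + h) - ?H (\<phi> * y)"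
        using increment_le_static_scaled[OF orders(3,4)] by (intro exI[of _ 1]) auto
    qed (use \<phi> in simp)
    with \<pi>(1) show ?thesis by blast
  qed
qed

end

theorem theorem6:
  fixes k :: nat and D :: "nat \<Rightarrow> real pmf" and c :: "nat \<Rightarrow> real"
  assumes "additive_box k D c"
  shows "(k = 2 \<longrightarrow>
           (\<exists>\<pi>. static_commitment k D c \<pi> \<and>
              pointwise_approx (additive_mdp k D c) \<pi> ((1 + sqrt 5) / 2))) \<and>
         (k \<ge> 3 \<longrightarrow>
           (\<forall>\<pi>. min_index_static k D c \<pi> \<longrightarrow>
              pointwise_approx (additive_mdp k D c) \<pi> (1 + real ((k + 1) div 2))))"
proof -
  interpret additive_components k D c
    by unfold_locales (fact assms)
  have "\<exists>\<pi>. static_commitment k D c \<pi> \<and> pointwise_approx (additive_mdp k D c) \<pi> ((1 + sqrt 5) / 2)"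
    if "k = 2"
  proof -
    \<comment> \<open>Whichever order has the smaller index plays the role of
      \<open>[i, j]\<close>.\<close>
    have "{..<k} = {0, 1}" "{..<k} = {1, 0}" using that by auto
    then show ?thesis
      using two_components_approx[of 0 1] two_components_approx[of 1 0]
      by (metis linear zero_neq_one)
  qed
  then show ?thesis
    using min_index_static_approx by blast
qed

end
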